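(* Let $p>1$, $p'=p/(p-1)$, and let $(\mathcal{X},\mathcal{F},\{\mathcal{F}_n\}_{n\ge0},\mu)$ be a discrete-time filtered probability space. If $f\in L^p(\mathcal{X},\mathcal{F},\mu)$ and $\{\alpha_n\}_{n\ge0}$ is a Carleson sequence with constant $C$, then $$\mathbb{E}^\mu\Big[\sum_{n\ge0}\alpha_n|f_n|^p\Big]\le (p')^p\, C\,\mathbb{E}^\mu[|f|^p].$$ Moreover, if $\{\mathcal{F}_n\}_{n\ge0}$ is an infinitely refining filtration, then the constant $(p')^p$ is sharp: for every $K<(p')^p$ there exist $f\in L^p$ and a Carleson sequence $\{\alpha_n\}$ with some constant $C$ such that $\mathbb{E}^\mu[\sum_n\alpha_n|f_n|^p]>K\,C\,\mathbb{E}^\mu[|f|^p]$.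
   Context: A discrete-time filtration is a sequence of $\sigma$-fields $\{\emptyset,\mathcal{X}\}=\mathcal{F}_0\subseteq\mathcal{F}_1\subseteq\cdots\subseteq\mathcal{F}$. Write $f_n=\mathbb{E}^\mu[f\mid\mathcal{F}_n]$. A sequence of non-negative random variables $\{\alpha_n\}_{n\ge0}$ is a Carleson sequence (with constant $C$) if each $\alpha_n$ is $\mathcal{F}_n$-measurable and $\mathbb{E}^\mu[\sum_{k\ge n}\alpha_k\mid\mathcal{F}_n]\le C$ a.s. for every $n\ge0$. The filtration is infinitely refining if for every $\varepsilon>0$, every $n\ge0$ and every $E\in\mathcal{F}_n$ there exist $k>n$ and a real-valued $\mathcal{F}_k$-measurable random variable $h$ such that (i) $|h\mathbf{1}_E|=\mathbf{1}_E$ and (ii) $\int_E|h_n|\,d\mu\le\varepsilon$, where $h_n=\mathbb{E}^\mu[h\mid\mathcal{F}_n]$. *)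

theory Defs
  imports "HOL-Probability.Probability"
begin

definition discrete_filtration :: "'a measure \<Rightarrow> (nat \<Rightarrow> 'a measure) \<Rightarrow> bool" where
  "discrete_filtration M F \<longleftrightarrow>
     (\<forall>n. subalgebra M (F n)) \<and>
     (\<forall>n. sets (F n) \<subseteq> sets (F (Suc n))) \<and>
     sets (F 0) = {{}, space M}"

definition carleson_seq ::
  "'a measure \<Rightarrow> (nat \<Rightarrow> 'a measure) \<Rightarrow> (nat \<Rightarrow> 'a \<Rightarrow> real) \<Rightarrow> real \<Rightarrow> bool" where
  "carleson_seq M F \<alpha> C \<longleftrightarrow>
     (\<forall>n. \<alpha> n \<in> borel_measurable (F n)) \<and>
     (\<forall>n. \<forall>x\<in>space M. 0 \<le> \<alpha> n x) \<and>
     (\<forall>n. AE x in M.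
        enn2ereal (nn_cond_exp M (F n) (\<lambda>y. \<Sum>k. ennreal (\<alpha> (n + k) y)) x) \<le> ereal C)"

definition infinitely_refining :: "'a measure \<Rightarrow> (nat \<Rightarrow> 'a measure) \<Rightarrow> bool" where
  "infinitely_refining M F \<longleftrightarrow>
     (\<forall>\<epsilon>>0. \<forall>n. \<forall>E\<in>sets (F n). \<exists>k>n. \<exists>h::'a \<Rightarrow> real.
        h \<in> borel_measurable (F k) \<and> integrable M h \<and>
        (\<forall>x\<in>space M. \<bar>h x * indicator E x\<bar> = indicator E x) \<and>
        (\<integral>x\<in>E. \<bar>real_cond_exp M (F n) h x\<bar> \<partial>M) \<le> \<epsilon>)"

end

theory Submission
  imports Defs
begin

text \<open>
  Upper bound: let \<open>g\<^sub>n\<close> be the running maximum of \<open>\<bar>f\<^sub>k\<bar>\<close>. Summation by parts turns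
  \<open>\<Sum>\<^sub>n \<alpha>\<^sub>n g\<^sub>n\<^sup>p\<close> into a sum of the increments of \<open>g\<^sup>p\<close> against the tails of \<open>\<alpha>\<close>; conditioning
  bounds the tails by \<open>C\<close>, and Doob's maximal inequality finishes the proof. Doob's inequality
  follows from the pathwise bound of the increments of \<open>g\<^sup>p\<close> by \<open>p' \<bar>f\<^sub>n\<bar>\<close> times those of
  \<open>g\<^bsup>p-1\<^esup>\<close> and Young's inequality.

  Sharpness: infinite refinement yields a decreasing chain of events \<open>G\<^sub>j\<close>, known at times \<open>t\<^sub>j\<close>,
  that loses about the fraction \<open>\<delta>\<close> of its mass in every step. The indicators of the \<open>G\<^sub>j\<close> form a
  Carleson sequence with constant about \<open>1/\<delta>\<close>, and a truncation of the function equal to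
  \<open>\<mu>(G\<^sub>j)\<^bsup>-1/p\<^esup>\<close> on \<open>G\<^sub>j - G\<^sub>j\<^sub>+\<^sub>1\<close> (a discrete \<open>x\<^bsup>-1/p\<^esup>\<close>) has mean about \<open>p' \<mu>(G\<^sub>j)\<^bsup>-1/p\<^esup>\<close> over \<open>G\<^sub>j\<close>.
  The refinement is controlled only in \<open>L\<^sup>1\<close>, so the chain satisfies an almost sure upper bound on
  conditional probabilities (for the Carleson condition) but lower bounds only on total masses;
  by Jensen's inequality the latter suffice for the test function.
\<close>

section \<open>Elementary inequalities and filtrations\<close>

text \<open>Tangent line at \<open>c\<close> to the convex function
  \<open>\<bar>y\<bar> powr p\<close>: Young's inequality for \<open>\<bar>y\<bar>\<close> and
  \<open>c powr (p - 1)\<close>, multiplied by \<open>p\<close>.\<close>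

lemma powr_ge_tangent:
  fixes y c p :: real
  assumes "p > 1" "0 \<le> c"
  shows "p * c powr (p - 1) * y - (p - 1) * c powr p \<le> \<bar>y\<bar> powr p"
proof -
  define q where "q = p / (p - 1)"
  have q: "q > 1" "1 / p + 1 / q = 1" "(p - 1) * q = p"
    using assms by (auto simp: q_def field_simps)
  have "\<bar>y\<bar> * c powr (p - 1) \<le> \<bar>y\<bar> powr p / p + (c powr (p - 1)) powr q / q"
    using q assms by (intro Youngs_inequality) auto
  also have "(c powr (p - 1)) powr q = c powr p"
    using q by (simp add: powr_powr)
  finally have "p * (\<bar>y\<bar> * c powr (p - 1)) \<le> p * (\<bar>y\<bar> powr p / p + c powr p / q)"
    using assms by (intro mult_left_mono) auto
  also have "\<dots> = \<bar>y\<bar> powr p + (p - 1) * c powr p"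
    using assms by (simp add: q_def field_simps)
  finally have "p * c powr (p - 1) * \<bar>y\<bar> - (p - 1) * c powr p \<le> \<bar>y\<bar> powr p"
    by (simp add: algebra_simps)
  moreover have "p * c powr (p - 1) * y \<le> p * c powr (p - 1) * \<bar>y\<bar>"
    using assms by (intro mult_left_mono) auto
  ultimately show ?thesis by linarith
qed

text \<open>The tangent inequality for the conjugate exponent \<open>q\<close>, with tangent point
  \<open>a powr (p - 1)\<close> and argument \<open>b powr (p - 1)\<close>. Since (p - 1) q = p and
  (p - 1)(q - 1) = 1, all powers of \<open>a\<close> and \<open>b\<close> come out as
  required.\<close>

lemma powr_diff_le:
  fixes a b p :: real
  assumes "p > 1" "0 \<le> b" "0 \<le> a"
  shows "a powr p - b powr p \<le> p / (p - 1) * (a * (a powr (p - 1) - b powr (p - 1)))"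
proof -
  define q where "q = p / (p - 1)"
  have q: "q > 1" "(p - 1) * q = p" "(p - 1) * (q - 1) = 1" "q - 1 = 1 / (p - 1)"
    using assms by (auto simp: q_def field_simps)
  have "q * (a powr (p-1)) powr (q - 1) * b powr (p-1) - (q - 1) * (a powr (p-1)) powr q
      \<le> \<bar>b powr (p-1)\<bar> powr q"
    using q by (intro powr_ge_tangent) auto
  then have "q * a * b powr (p-1) - (q - 1) * a powr p \<le> b powr p"
    using q assms by (simp add: powr_powr)
  moreover have "a * a powr (p-1) = a powr p"
    using assms by (simp add: powr_mult_base)
  ultimately show ?thesis
    unfolding q_def[symmetric] by (simp add: algebra_simps)
qed

text \<open>The concave function x^(1 - 1/p) lies below its tangent at \<open>b\<close>, by the
  weighted AM-GM inequality. This later compares a sum of values x^(-1/p) with increments of the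
  antiderivative p' x^(1 - 1/p).\<close>

lemma powr_diff_le_concave:
  fixes a b p :: real
  assumes "p > 1" "0 < b" "0 < a"
  shows "p / (p - 1) * (a powr (1 - 1/p) - b powr (1 - 1/p)) \<le> b powr (-1/p) * (a - b)"
proof -
  have "a powr (1 - 1/p) * b powr (1/p) \<le> (1 - 1/p) * a + (1/p) * b"
    using assms by (intro Youngs_inequality_0) auto
  then have "a powr (1 - 1/p) * b powr (1/p) * b powr (-1/p) \<le> ((1 - 1/p) * a + (1/p) * b) * b powr (-1/p)"
    by (intro mult_right_mono) auto
  moreover have "a powr (1 - 1/p) * b powr (1/p) * b powr (-1/p) = a powr (1 - 1/p)"
    using assms by (simp add: mult.assoc powr_add[symmetric])
  moreover have "b * b powr (-1/p) = b powr (1 - 1/p)"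
    using assms by (simp add: powr_mult_base)
  ultimately have "a powr (1 - 1/p) \<le> (1 - 1/p) * a * b powr (-1/p) + (1/p) * b powr (1 - 1/p)"
    by (simp only: distrib_right mult.assoc)
  then have "a powr (1 - 1/p) - b powr (1 - 1/p) \<le> (1 - 1/p) * (b powr (-1/p) * (a - b))"
    using \<open>b * b powr (-1/p) = b powr (1 - 1/p)\<close> by (simp add: algebra_simps)
  then have "p / (p - 1) * (a powr (1 - 1/p) - b powr (1 - 1/p))
      \<le> p / (p - 1) * ((1 - 1/p) * (b powr (-1/p) * (a - b)))"
    using assms by (intro mult_left_mono) auto
  also have "p / (p - 1) * (1 - 1/p) = 1"
    using assms by (simp add: field_simps)
  then have "p / (p - 1) * ((1 - 1/p) * (b powr (-1/p) * (a - b))) = b powr (-1/p) * (a - b)"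
    by (metis mult.assoc mult_1)
  finally show ?thesis .
qed

section \<open>Conditioning on, and inclusions within, a filtration\<close>

lemma sigma_finite_subalgebra_filtration:
  assumes "prob_space M" "discrete_filtration M F"
  shows "sigma_finite_subalgebra M (F n)"
  using assms
  by (intro finite_measure_subalgebra_is_sigma_finite)
    (simp add: finite_measure_subalgebra_def finite_measure_subalgebra_axioms_def
      prob_space.finite_measure discrete_filtration_def)

lemma filtration_mono:
  assumes "discrete_filtration M F" "m \<le> n"
  shows "sets (F m) \<subseteq> sets (F n)"
  by (rule lift_Suc_mono_le[of "\<lambda>n. sets (F n)"])
    (use assms in \<open>auto simp: discrete_filtration_def\<close>)

lemma measurable_filtration_mono:
  assumes "discrete_filtration M F" "m \<le> n" "g \<in> measurable (F m) N"
  shows "g \<in> measurable (F n) N"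
proof -
  have "space (F m) = space (F n)"
    using assms(1) by (simp add: discrete_filtration_def subalgebra_def)
  then show ?thesis
    using assms(3) filtration_mono[OF assms(1,2)] by (auto simp: measurable_def)
qed

text \<open>Summation by parts in the form of Tonelli over the region j \<le> n, with the series
  read as integrals for counting measure. If \<open>d\<close> lists increments, the inner sum on the
  left is the accumulated value and the one on the right is a tail of \<open>a\<close>.\<close>

lemma suminf_mult_partial_sums_eq:
  fixes a d :: "nat \<Rightarrow> ennreal"
  shows "(\<Sum>n. a n * (\<Sum>j\<le>n. d j)) = (\<Sum>j. d j * (\<Sum>k. a (j + k)))"
proof -
  define u where "u = (\<lambda>n j. if j \<le> n then a n * d j else 0)"
  have 1: "(\<Sum>j. u n j) = a n * (\<Sum>j\<le>n. d j)" for n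
  proof -
    have "(\<Sum>j. u n j) = (\<Sum>j\<le>n. u n j)"
      by (rule suminf_finite) (auto simp: u_def)
    then show ?thesis by (simp add: u_def sum_distrib_left)
  qed
  have 2: "(\<Sum>n. u n j) = d j * (\<Sum>k. a (j + k))" for j
  proof -
    have "(\<Sum>n. u n j) = (\<Sum>k. u (j + k) j)"
      by (rule suminf_mono_reindex[symmetric])
        (auto simp: strict_mono_def u_def image_iff le_iff_add)
    then show ?thesis by (simp add: u_def mult.commute)
  qed
  have "(\<Sum>n. \<Sum>j. u n j) = (\<integral>\<^sup>+n. (\<Sum>j. u n j) \<partial>count_space UNIV)"
    by (simp add: nn_integral_count_space_nat)
  also have "\<dots> = (\<Sum>j. \<integral>\<^sup>+n. u n j \<partial>count_space UNIV)"
    by (rule nn_integral_suminf) simp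
  also have "\<dots> = (\<Sum>j. \<Sum>n. u n j)"
    by (simp add: nn_integral_count_space_nat)
  finally show ?thesis by (simp add: 1 2)
qed

section \<open>Doob's maximal inequality\<close>

text \<open>The index is shifted: stage \<open>n\<close> sees only the entries before
  \<open>n\<close>. Hence stage 0 is 0, so telescoping sums have no initial term, and the increment
  from \<open>n\<close> to \<open>Suc n\<close> is known at time \<open>n\<close>.\<close>

primrec running_max :: "(nat \<Rightarrow> real) \<Rightarrow> nat \<Rightarrow> real" where
  "running_max s 0 = 0"
| "running_max s (Suc n) = max (running_max s n) (s n)"

lemma running_max_nonneg: "0 \<le> running_max s n"
  by (induction n) auto

text \<open>A crude bound, used only to see that each finite maximum has an integrable
  power.\<close>

lemma running_max_powr_le_sum:
  assumes "\<And>k. 0 \<le> s k" "p > 0"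
  shows "running_max s n powr p \<le> (\<Sum>k<n. s k powr p)"
proof (induction n)
  case (Suc n)
  have "running_max s (Suc n) powr p \<le> running_max s n powr p + s n powr p"
    by (simp add: max_def)
  with Suc show ?case by simp
qed simp

text \<open>The factor \<^term>\<open>s n\<close> may replace the maximum because the maximum only grows when it is
  attained at \<^term>\<open>n\<close>.\<close>
lemma running_max_increment_le:
  assumes "p > 1" "0 \<le> s n"
  shows "running_max s (Suc n) powr p - running_max s n powr p
    \<le> p / (p - 1) * (s n * (running_max s (Suc n) powr (p - 1) - running_max s n powr (p - 1)))"
proof (cases "s n \<le> running_max s n")
  case False
  then show ?thesis
    using powr_diff_le[OF assms(1) running_max_nonneg assms(2)] by (simp add: max_def)
qed (simp add: max_def)

lemma measurable_running_max:
  assumes "discrete_filtration M F" "\<And>k. s k \<in> borel_measurable (F k)"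
  shows "(\<lambda>x. running_max (\<lambda>k. s k x) (Suc n)) \<in> borel_measurable (F n)"
    and "(\<lambda>x. running_max (\<lambda>k. s k x) n) \<in> borel_measurable (F n)"
proof -
  have *: "(\<lambda>x. running_max (\<lambda>k. s k x) m) \<in> borel_measurable (F n)" if "m \<le> Suc n" for m
    using that
  proof (induction m)
    case (Suc m)
    then have "s m \<in> borel_measurable (F n)"
      using measurable_filtration_mono[OF assms(1) _ assms(2), of m n] by simp
    with Suc show ?case by simp
  qed simp
  show "(\<lambda>x. running_max (\<lambda>k. s k x) (Suc n)) \<in> borel_measurable (F n)"
    and "(\<lambda>x. running_max (\<lambda>k. s k x) n) \<in> borel_measurable (F n)"
    by (rule *; simp)+
qed

text \<open>Every nonzero \<open>z\<close> has a supporting line \<open>l\<close>, namely the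
  tangent at \<bar>z\<bar> reflected by the sign of \<open>z\<close>; at 0 the value is the minimum
  0. Convexity feeds the conditional Jensen inequality, which makes the powers of \<bar>f_k\<bar>
  integrable.\<close>

lemma convex_on_abs_powr:
  fixes p :: real
  assumes "p > 1"
  shows "convex_on UNIV (\<lambda>x. \<bar>x\<bar> powr p)"
proof (rule convex_onI)
  fix t x y :: real
  assume t: "0 < t" "t < 1"
  define z where "z = (1 - t) *\<^sub>R x + t *\<^sub>R y"
  define l where "l = (\<lambda>w. p * \<bar>z\<bar> powr (p - 1) * (sgn z * w) - (p - 1) * \<bar>z\<bar> powr p)"
  have le: "l w \<le> \<bar>w\<bar> powr p" if "z \<noteq> 0" for w
    using powr_ge_tangent[OF assms abs_ge_zero, of z "sgn z * w"] that
    by (simp add: l_def abs_mult abs_sgn_eq)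
  show "\<bar>(1 - t) *\<^sub>R x + t *\<^sub>R y\<bar> powr p \<le> (1 - t) * \<bar>x\<bar> powr p + t * \<bar>y\<bar> powr p"
  proof (cases "z = 0")
    case True
    then show ?thesis using t unfolding z_def by simp
  next
    case False
    have "\<bar>z\<bar> powr (p - 1) * (sgn z * z) = \<bar>z\<bar> powr p"
      using powr_mult_base[of "\<bar>z\<bar>" "p - 1"] by (simp add: mult.commute flip: abs_sgn)
    then have "p * \<bar>z\<bar> powr (p - 1) * (sgn z * z) = p * \<bar>z\<bar> powr p"
      by (simp only: mult.assoc)
    then have "l z = p * \<bar>z\<bar> powr p - (p - 1) * \<bar>z\<bar> powr p"
      by (simp only: l_def)
    then have "\<bar>z\<bar> powr p = l z"
      by (simp add: algebra_simps)
    also have "\<dots> = (1 - t) * l x + t * l y"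
      by (simp add: l_def z_def algebra_simps)
    also have "\<dots> \<le> (1 - t) * \<bar>x\<bar> powr p + t * \<bar>y\<bar> powr p"
      using t le[OF False] by (intro add_mono mult_left_mono) auto
    finally show ?thesis unfolding z_def .
  qed
qed simp

lemma (in finite_measure) integrable_of_integrable_powr:
  fixes f :: "'a \<Rightarrow> real"
  assumes "f \<in> borel_measurable M" "integrable M (\<lambda>x. \<bar>f x\<bar> powr p)" "p \<ge> 1"
  shows "integrable M f"
proof (rule Bochner_Integration.integrable_bound)
  show "integrable M (\<lambda>x. 1 + \<bar>f x\<bar> powr p)"
    using assms by simp
  have "\<bar>y\<bar> \<le> 1 + \<bar>y\<bar> powr p" for y :: real
  proof (cases "\<bar>y\<bar> \<le> 1")
    case False
    then have "\<bar>y\<bar> powr 1 \<le> \<bar>y\<bar> powr p"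
      using assms by (intro powr_mono) auto
    then show ?thesis by simp
  qed (simp add: add_increasing2)
  then show "AE x in M. norm (f x) \<le> norm (1 + \<bar>f x\<bar> powr p)"
    by simp
qed (use assms in auto)

text \<open>The pathwise increment bounds are integrated, conditioning replaces \<bar>f_k\<bar> by
  \<bar>f\<bar>, and the increments \<open>e k\<close> telescope back to the power p - 1 of the
  maximum. Young's inequality then returns a fraction of the left side, which is absorbed.\<close>

theorem Doob_maximal_Lp:
  fixes f :: "'a \<Rightarrow> real"
  assumes "prob_space M" and filt: "discrete_filtration M F" and p: "p > 1"
    and f [measurable]: "f \<in> borel_measurable M"
    and fp: "integrable M (\<lambda>x. \<bar>f x\<bar> powr p)"
  defines "g \<equiv> \<lambda>n x. running_max (\<lambda>k. \<bar>real_cond_exp M (F k) f x\<bar>) n"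
  shows "integrable M (\<lambda>x. g n x powr p)"
    and "(\<integral>x. g n x powr p \<partial>M) \<le> (p / (p - 1)) powr p * (\<integral>x. \<bar>f x\<bar> powr p \<partial>M)"
proof -
  interpret prob_space M by fact
  interpret cond: sigma_finite_subalgebra M "F i" for i
    using assms(1,2) by (rule sigma_finite_subalgebra_filtration)
  define q where "q = p / (p - 1)"
  have q: "q > 1" "1 / p + 1 / q = 1" "(p - 1) * q = p"
    using p by (auto simp: q_def field_simps)
  have int_f: "integrable M f"
    using f fp p by (intro integrable_of_integrable_powr[of f p]) auto
  have int_fn: "integrable M (\<lambda>x. \<bar>real_cond_exp M (F k) f x\<bar> powr p)" for k
    using cond.integrable_convex_cond_exp[OF int_f, of UNIV 0 0 "\<lambda>x. \<bar>x\<bar> powr p" k]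
      fp convex_on_abs_powr[OF p] by simp
  have gF [measurable]: "g (Suc k) \<in> borel_measurable (F k)" "g k \<in> borel_measurable (F k)" for k
    unfolding g_def by (rule measurable_running_max[OF filt]; measurable)+
  have gM [measurable]: "g k \<in> borel_measurable M" for k
    by (rule measurable_from_subalg[OF cond.subalg gF(2)])
  have g0: "0 \<le> g k x" for k x
    by (simp add: g_def running_max_nonneg)
  have g_mono: "g k x powr r \<le> g (Suc k) x powr r" if "r \<ge> 0" for k x r
    using that g0 by (intro powr_mono2) (auto simp: g_def)
  \<comment> \<open>Finiteness comes first because a multiple of this integral is subtracted from
    both sides at the end.\<close>
  show int_g: "integrable M (\<lambda>x. g n x powr p)"
  proof (rule Bochner_Integration.integrable_bound)
    show "integrable M (\<lambda>x. \<Sum>k<n. \<bar>real_cond_exp M (F k) f x\<bar> powr p)"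
      using int_fn by (intro Bochner_Integration.integrable_sum)
    show "AE x in M. norm (g n x powr p) \<le> norm (\<Sum>k<n. \<bar>real_cond_exp M (F k) f x\<bar> powr p)"
      using p running_max_powr_le_sum[of "\<lambda>k. \<bar>real_cond_exp M (F k) f _\<bar>" p n]
      by (auto simp: g_def sum_nonneg)
  qed simp
  define e where "e = (\<lambda>k x. g (Suc k) x powr (p - 1) - g k x powr (p - 1))"
  have e0: "0 \<le> e k x" for k x
    using g_mono[of "p - 1" k x] p by (simp add: e_def)
  have eF [measurable]: "e k \<in> borel_measurable (F k)" for k
    unfolding e_def by measurable
  have eM [measurable]: "e k \<in> borel_measurable M" for k
    by (rule measurable_from_subalg[OF cond.subalg eF])
  have step: "(\<integral>\<^sup>+x. ennreal (g (Suc k) x powr p - g k x powr p) \<partial>M)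
      \<le> (\<integral>\<^sup>+x. ennreal (q * e k x * \<bar>f x\<bar>) \<partial>M)" for k
  proof -
    have "(\<integral>\<^sup>+x. ennreal (g (Suc k) x powr p - g k x powr p) \<partial>M)
        \<le> (\<integral>\<^sup>+x. ennreal (q * e k x) * ennreal \<bar>real_cond_exp M (F k) f x\<bar> \<partial>M)"
    proof (intro nn_integral_mono)
      fix x
      have "g (Suc k) x powr p - g k x powr p \<le> q * e k x * \<bar>real_cond_exp M (F k) f x\<bar>"
        using running_max_increment_le[OF p, of "\<lambda>k. \<bar>real_cond_exp M (F k) f x\<bar>" k]
        unfolding g_def q_def e_def by (simp only: abs_ge_zero mult.assoc mult.commute[of "\<bar>_\<bar>"])
      then show "ennreal (g (Suc k) x powr p - g k x powr p)
          \<le> ennreal (q * e k x) * ennreal \<bar>real_cond_exp M (F k) f x\<bar>"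
        using q e0[of k x] by (subst ennreal_mult[symmetric]) (auto intro: ennreal_leI)
    qed
    \<comment> \<open>Here \<bar>E[f | F_k]\<bar> \<le> E[\<bar>f\<bar> | F_k]; as
      \<open>e k\<close> is known at time \<open>k\<close>, the conditional expectation can then be
      dropped under the integral.\<close>
    also have "\<dots> \<le> (\<integral>\<^sup>+x. ennreal (q * e k x) * nn_cond_exp M (F k) (\<lambda>x. ennreal \<bar>f x\<bar>) x \<partial>M)"
      using cond.real_cond_exp_abs[OF f, of k]
      by (intro nn_integral_mono_AE) (auto elim!: eventually_mono intro: mult_left_mono)
    also have "\<dots> = (\<integral>\<^sup>+x. ennreal (q * e k x) * ennreal \<bar>f x\<bar> \<partial>M)"
      by (rule cond.nn_cond_exp_intg) measurable
    also have "\<dots> = (\<integral>\<^sup>+x. ennreal (q * e k x * \<bar>f x\<bar>) \<partial>M)"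
      using q e0 by (simp add: ennreal_mult')
    finally show ?thesis .
  qed
  have "(\<integral>\<^sup>+x. ennreal (g n x powr p) \<partial>M)
      = (\<integral>\<^sup>+x. (\<Sum>k<n. ennreal (g (Suc k) x powr p - g k x powr p)) \<partial>M)"
  proof (rule nn_integral_cong)
    fix x
    have "(\<Sum>k<n. g (Suc k) x powr p - g k x powr p) = g n x powr p"
      unfolding sum_lessThan_telescope[where f = "\<lambda>k. g k x powr p"] by (simp add: g_def)
    then show "ennreal (g n x powr p) = (\<Sum>k<n. ennreal (g (Suc k) x powr p - g k x powr p))"
      using g_mono p by (subst sum_ennreal) auto
  qed
  also have "\<dots> = (\<Sum>k<n. \<integral>\<^sup>+x. ennreal (g (Suc k) x powr p - g k x powr p) \<partial>M)"
    by (rule nn_integral_sum) measurable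
  also have "\<dots> \<le> (\<Sum>k<n. \<integral>\<^sup>+x. ennreal (q * e k x * \<bar>f x\<bar>) \<partial>M)"
    by (intro sum_mono step)
  also have "\<dots> = (\<integral>\<^sup>+x. (\<Sum>k<n. ennreal (q * e k x * \<bar>f x\<bar>)) \<partial>M)"
    by (rule nn_integral_sum[symmetric]) measurable
  also have "\<dots> = (\<integral>\<^sup>+x. ennreal (q * \<bar>f x\<bar> * g n x powr (p - 1)) \<partial>M)"
  proof (rule nn_integral_cong)
    fix x
    have "(\<Sum>k<n. q * e k x * \<bar>f x\<bar>) = q * \<bar>f x\<bar> * (\<Sum>k<n. e k x)"
      by (simp add: sum_distrib_left ac_simps)
    also have "(\<Sum>k<n. e k x) = g n x powr (p - 1)"
      unfolding e_def sum_lessThan_telescope[where f = "\<lambda>k. g k x powr (p - 1)"] by (simp add: g_def)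
    finally show "(\<Sum>k<n. ennreal (q * e k x * \<bar>f x\<bar>)) = ennreal (q * \<bar>f x\<bar> * g n x powr (p - 1))"
      using q e0 by (subst sum_ennreal) auto
  qed
  \<comment> \<open>Grouping the factor \<open>q\<close> with \<bar>f\<bar> leaves the coefficient
    1/q on the maximum. Absorbing it leaves 1 - 1/q = 1/p, which cancels the 1/p of the other term
    and gives exactly q^p.\<close>
  also have "\<dots> \<le> (\<integral>\<^sup>+x. ennreal (q powr p / p * \<bar>f x\<bar> powr p + g n x powr p / q) \<partial>M)"
  proof (intro nn_integral_mono ennreal_leI)
    fix x
    have "q * \<bar>f x\<bar> * g n x powr (p - 1)
        \<le> (q * \<bar>f x\<bar>) powr p / p + (g n x powr (p - 1)) powr q / q"
      using p q by (intro Youngs_inequality) auto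
    then show "q * \<bar>f x\<bar> * g n x powr (p - 1) \<le> q powr p / p * \<bar>f x\<bar> powr p + g n x powr p / q"
      using q by (simp add: powr_powr powr_mult)
  qed
  also have "\<dots> = ennreal (\<integral>x. q powr p / p * \<bar>f x\<bar> powr p + g n x powr p / q \<partial>M)"
    using fp int_g p q by (intro nn_integral_eq_integral) auto
  also have "(\<integral>x. q powr p / p * \<bar>f x\<bar> powr p + g n x powr p / q \<partial>M)
      = q powr p / p * (\<integral>x. \<bar>f x\<bar> powr p \<partial>M) + (\<integral>x. g n x powr p \<partial>M) / q"
    using fp int_g by simp
  also have "(\<integral>\<^sup>+x. ennreal (g n x powr p) \<partial>M) = ennreal (\<integral>x. g n x powr p \<partial>M)"
    using int_g by (intro nn_integral_eq_integral) auto
  finally have "(\<integral>x. g n x powr p \<partial>M)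
      \<le> q powr p / p * (\<integral>x. \<bar>f x\<bar> powr p \<partial>M) + (\<integral>x. g n x powr p \<partial>M) / q"
    using p q by (subst (asm) ennreal_le_iff) auto
  moreover have "(\<integral>x. g n x powr p \<partial>M) / q = (\<integral>x. g n x powr p \<partial>M) - (\<integral>x. g n x powr p \<partial>M) / p"
    using p by (simp add: q_def field_simps)
  ultimately have "(\<integral>x. g n x powr p \<partial>M) / p \<le> q powr p * (\<integral>x. \<bar>f x\<bar> powr p \<partial>M) / p"
    by simp
  then show "(\<integral>x. g n x powr p \<partial>M) \<le> (p / (p - 1)) powr p * (\<integral>x. \<bar>f x\<bar> powr p \<partial>M)"
    using p unfolding q_def by (simp add: divide_le_cancel)
qed

section \<open>The embedding inequality\<close>

text \<open>The comparison in \<open>ereal\<close> does not truncate a negative \<open>C\<close> to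
  0; a nonnegative function bounded by \<open>C\<close> almost surely on a probability space then
  forces \<open>C\<close> to be nonnegative. After that the bound can be stated in
  \<open>ennreal\<close>.\<close>

lemma carleson_seqD:
  assumes "prob_space M" "carleson_seq M F \<alpha> C"
  shows "0 \<le> C"
    and "AE x in M. nn_cond_exp M (F n) (\<lambda>y. \<Sum>k. ennreal (\<alpha> (n + k) y)) x \<le> ennreal C"
proof -
  interpret prob_space M by fact
  have AE: "AE x in M. enn2ereal (nn_cond_exp M (F n) (\<lambda>y. \<Sum>k. ennreal (\<alpha> (n + k) y)) x) \<le> ereal C" for n
    using assms(2) by (simp add: carleson_seq_def)
  have "AE x in M. 0 \<le> C"
    using AE[of 0] by eventually_elim (meson ereal_less_eq(5) enn2ereal_nonneg order_trans)
  then show C: "0 \<le> C" by simp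
  show "AE x in M. nn_cond_exp M (F n) (\<lambda>y. \<Sum>k. ennreal (\<alpha> (n + k) y)) x \<le> ennreal C"
    using AE[of n] by eventually_elim (simp add: C less_eq_ennreal.rep_eq)
qed

theorem carleson_embedding:
  fixes f :: "'a \<Rightarrow> real"
  assumes "prob_space M" and filt: "discrete_filtration M F" and p: "p > 1"
    and f [measurable]: "f \<in> borel_measurable M"
    and fp: "integrable M (\<lambda>x. \<bar>f x\<bar> powr p)"
    and \<alpha>: "carleson_seq M F \<alpha> C"
  shows "(\<integral>\<^sup>+ x. (\<Sum>n. ennreal (\<alpha> n x * \<bar>real_cond_exp M (F n) f x\<bar> powr p)) \<partial>M)
    \<le> ennreal ((p / (p - 1)) powr p * C * (\<integral>x. \<bar>f x\<bar> powr p \<partial>M))"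
proof -
  interpret prob_space M by fact
  interpret cond: sigma_finite_subalgebra M "F i" for i
    using assms(1,2) by (rule sigma_finite_subalgebra_filtration)
  define g where "g = (\<lambda>n x. running_max (\<lambda>k. \<bar>real_cond_exp M (F k) f x\<bar>) n)"
  define I where "I = (p / (p - 1)) powr p * (\<integral>x. \<bar>f x\<bar> powr p \<partial>M)"
  have C: "0 \<le> C" and AE_C: "AE x in M. nn_cond_exp M (F n) (\<lambda>y. \<Sum>k. ennreal (\<alpha> (n + k) y)) x \<le> ennreal C" for n
    using carleson_seqD[OF assms(1) \<alpha>] by auto
  have \<alpha>F: "\<alpha> n \<in> borel_measurable (F n)" and \<alpha>0: "x \<in> space M \<Longrightarrow> 0 \<le> \<alpha> n x" for n x
    using \<alpha> by (auto simp: carleson_seq_def)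
  have [measurable]: "\<alpha> n \<in> borel_measurable M" for n
    by (rule measurable_from_subalg[OF cond.subalg \<alpha>F])
  have gF [measurable]: "g (Suc k) \<in> borel_measurable (F k)" "g k \<in> borel_measurable (F k)" for k
    unfolding g_def by (rule measurable_running_max[OF filt]; measurable)+
  have gM [measurable]: "g k \<in> borel_measurable M" for k
    by (rule measurable_from_subalg[OF cond.subalg gF(2)])
  define d where "d = (\<lambda>k x. g (Suc k) x powr p - g k x powr p)"
  have d0: "0 \<le> d k x" for k x
    using p running_max_nonneg by (auto simp: d_def g_def intro!: powr_mono2)
  have dF [measurable]: "d k \<in> borel_measurable (F k)" for k
    unfolding d_def by measurable
  have dM [measurable]: "d k \<in> borel_measurable M" for k
    by (rule measurable_from_subalg[OF cond.subalg dF])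
  have d_sum: "(\<Sum>k<n. ennreal (d k x)) = ennreal (g n x powr p)" for n x
    using d0 unfolding d_def
    by (simp add: sum_lessThan_telescope[where f = "\<lambda>k. g k x powr p"]) (simp add: g_def)
  have "(\<integral>\<^sup>+ x. (\<Sum>n. ennreal (\<alpha> n x * \<bar>real_cond_exp M (F n) f x\<bar> powr p)) \<partial>M)
      \<le> (\<integral>\<^sup>+ x. (\<Sum>n. ennreal (\<alpha> n x) * (\<Sum>k\<le>n. ennreal (d k x))) \<partial>M)"
  proof (intro nn_integral_mono suminf_le)
    fix x n assume x: "x \<in> space M"
    \<comment> \<open>Stage \<open>Suc n\<close> of the maximum includes the entry at time
      \<open>n\<close>, and its power is the sum of the increments \<open>d k\<close> with k \<le>
      n.\<close>
    have "\<bar>real_cond_exp M (F n) f x\<bar> powr p \<le> g (Suc n) x powr p"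
      using p by (intro powr_mono2) (auto simp: g_def)
    then show "ennreal (\<alpha> n x * \<bar>real_cond_exp M (F n) f x\<bar> powr p)
        \<le> ennreal (\<alpha> n x) * (\<Sum>k\<le>n. ennreal (d k x))"
      unfolding lessThan_Suc_atMost[symmetric] d_sum
      using \<alpha>0[OF x] by (subst ennreal_mult[symmetric]) (auto intro!: ennreal_leI mult_left_mono)
  qed auto
  also have "\<dots> = (\<integral>\<^sup>+ x. (\<Sum>j. ennreal (d j x) * (\<Sum>k. ennreal (\<alpha> (j + k) x))) \<partial>M)"
    by (simp only: suminf_mult_partial_sums_eq)
  also have "\<dots> = (\<Sum>j. \<integral>\<^sup>+ x. ennreal (d j x) * (\<Sum>k. ennreal (\<alpha> (j + k) x)) \<partial>M)"
    by (rule nn_integral_suminf) measurable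
  also have "\<dots> \<le> (\<Sum>j. ennreal C * (\<integral>\<^sup>+ x. ennreal (d j x) \<partial>M))"
  proof (intro suminf_le)
    fix j
    \<comment> \<open>The increment \<open>d j\<close> is known at time \<open>j\<close>, so the
      tail of \<alpha> may be replaced by its conditional expectation, where the Carleson bound
      applies.\<close>
    have "(\<integral>\<^sup>+ x. ennreal (d j x) * (\<Sum>k. ennreal (\<alpha> (j + k) x)) \<partial>M)
        = (\<integral>\<^sup>+ x. ennreal (d j x) * nn_cond_exp M (F j) (\<lambda>x. \<Sum>k. ennreal (\<alpha> (j + k) x)) x \<partial>M)"
      by (rule cond.nn_cond_exp_intg[symmetric]) measurable
    also have "\<dots> \<le> (\<integral>\<^sup>+ x. ennreal C * ennreal (d j x) \<partial>M)"
      using AE_C[of j]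
      by (intro nn_integral_mono_AE) (auto elim!: eventually_mono simp: mult.commute[of "ennreal C"] intro: mult_left_mono)
    also have "\<dots> = ennreal C * (\<integral>\<^sup>+ x. ennreal (d j x) \<partial>M)"
      by (rule nn_integral_cmult) measurable
    finally show "(\<integral>\<^sup>+ x. ennreal (d j x) * (\<Sum>k. ennreal (\<alpha> (j + k) x)) \<partial>M)
        \<le> ennreal C * (\<integral>\<^sup>+ x. ennreal (d j x) \<partial>M)" .
  qed auto
  also have "\<dots> = ennreal C * (\<Sum>j. \<integral>\<^sup>+ x. ennreal (d j x) \<partial>M)"
    by simp
  also have "\<dots> \<le> ennreal C * ennreal I"
  \<comment> \<open>The partial sums telescope to the integrals in Doob's inequality, whose bound
    does not depend on \<open>n\<close>.\<close>
  proof (intro mult_left_mono suminf_le_const)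
    fix n
    have "(\<Sum>j<n. \<integral>\<^sup>+ x. ennreal (d j x) \<partial>M) = (\<integral>\<^sup>+ x. ennreal (g n x powr p) \<partial>M)"
      by (subst nn_integral_sum[symmetric]) (auto simp: d_sum)
    also have "\<dots> = ennreal (\<integral>x. g n x powr p \<partial>M)"
      using Doob_maximal_Lp(1)[OF assms(1) filt p f fp, of n]
      by (intro nn_integral_eq_integral) (auto simp: g_def)
    also have "\<dots> \<le> ennreal I"
      using Doob_maximal_Lp(2)[OF assms(1) filt p f fp, of n]
      by (intro ennreal_leI) (auto simp: g_def I_def)
    finally show "(\<Sum>j<n. \<integral>\<^sup>+ x. ennreal (d j x) \<partial>M) \<le> ennreal I" .
  qed auto
  also have "\<dots> = ennreal ((p / (p - 1)) powr p * C * (\<integral>x. \<bar>f x\<bar> powr p \<partial>M))"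
    using C p by (subst ennreal_mult[symmetric]) (auto simp: I_def ac_simps)
  finally show ?thesis .
qed

section \<open>Thinning events in an infinitely refining filtration\<close>

text \<open>Take for \<open>B\<close> the subset of \<open>A\<close> where h = 1. As h is 1 or -1 on
  \<open>A\<close>, the indicator of \<open>B\<close> is half that of \<open>A\<close> plus half of
  h on \<open>A\<close>. For D in F_n the h-term may be replaced by its conditional expectation,
  which is small in L^1 on \<open>A\<close>, hence uniformly in \<open>D\<close>.\<close>

lemma infinitely_refining_halve:
  assumes "prob_space M" and filt: "discrete_filtration M F" and "infinitely_refining M F"
    and A: "A \<in> sets (F n)" and "\<epsilon> > 0"
  obtains k B where "k > n" "B \<in> sets (F k)" "B \<subseteq> A"
    "\<And>D. D \<in> sets (F n) \<Longrightarrow> \<bar>measure M (B \<inter> D) - measure M (A \<inter> D) / 2\<bar> \<le> \<epsilon>"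
proof -
  interpret prob_space M by fact
  interpret cond: sigma_finite_subalgebra M "F i" for i
    using assms(1,2) by (rule sigma_finite_subalgebra_filtration)
  have FM: "X \<in> sets M" if "X \<in> sets (F m)" for X m
    using that cond.subalg[of m] by (auto simp: subalgebra_def)
  obtain k and h :: "'a \<Rightarrow> real" where "k > n" and hk [measurable]: "h \<in> borel_measurable (F k)"
    and int_h: "integrable M h"
    and h1: "\<forall>x\<in>space M. \<bar>h x * indicator A x\<bar> = indicator A x"
    and h_small: "(\<integral>x\<in>A. \<bar>real_cond_exp M (F n) h x\<bar> \<partial>M) \<le> \<epsilon>"
    using assms(3)[unfolded infinitely_refining_def, rule_format, OF \<open>\<epsilon> > 0\<close> A]
    by blast
  have [measurable]: "A \<in> sets (F k)"
    using A filtration_mono[OF filt, of n k] \<open>k > n\<close> by auto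
  define B where "B = {x \<in> A. h x = 1}"
  have B: "B \<in> sets (F k)"
    unfolding B_def by measurable
  note [measurable] = FM[OF A] FM[OF B]
  have int_c: "integrable M (real_cond_exp M (F n) h)"
    using int_h by (rule cond.real_cond_exp_int)
  have "\<bar>measure M (B \<inter> D) - measure M (A \<inter> D) / 2\<bar> \<le> \<epsilon>" if D: "D \<in> sets (F n)" for D
  proof -
    note [measurable] = FM[OF D]
    have AD: "A \<inter> D \<in> sets (F n)" using A D by auto
    have "measure M (B \<inter> D) = (\<integral>x. indicator (B \<inter> D) x \<partial>M)"
      by simp
    also have "\<dots> = (\<integral>x. indicator (A \<inter> D) x / 2 + (indicator (A \<inter> D) x *\<^sub>R h x) / 2 \<partial>M)"
    proof (rule Bochner_Integration.integral_cong)
      fix x assume x: "x \<in> space M"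
      consider "x \<notin> A" | "x \<in> A" "h x = 1" | "x \<in> A" "h x = -1"
        using bspec[OF h1 x] by (cases "x \<in> A") (auto simp: abs_if split: if_splits)
      then show "indicator (B \<inter> D) x = indicator (A \<inter> D) x / 2 + (indicator (A \<inter> D) x *\<^sub>R h x) / 2"
        by cases (auto simp: B_def indicator_def)
    qed simp
    also have "\<dots> = measure M (A \<inter> D) / 2 + (\<integral>x\<in>A \<inter> D. h x \<partial>M) / 2"
      unfolding set_lebesgue_integral_def
      using integrable_mult_indicator[OF _ int_h, of "A \<inter> D"]
        integrable_real_indicator[of "A \<inter> D" M]
      by (subst Bochner_Integration.integral_add) (auto simp: less_top[symmetric])
    also have "(\<integral>x\<in>A \<inter> D. h x \<partial>M) = (\<integral>x\<in>A \<inter> D. real_cond_exp M (F n) h x \<partial>M)"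
      using int_h AD by (rule cond.real_cond_exp_intA)
    finally have eq: "measure M (B \<inter> D) - measure M (A \<inter> D) / 2
        = (\<integral>x\<in>A \<inter> D. real_cond_exp M (F n) h x \<partial>M) / 2"
      by simp
    have "\<bar>\<integral>x\<in>A \<inter> D. real_cond_exp M (F n) h x \<partial>M\<bar>
        \<le> (\<integral>x. \<bar>indicator (A \<inter> D) x *\<^sub>R real_cond_exp M (F n) h x\<bar> \<partial>M)"
      unfolding set_lebesgue_integral_def by (rule integral_abs_bound)
    also have "\<dots> \<le> (\<integral>x\<in>A. \<bar>real_cond_exp M (F n) h x\<bar> \<partial>M)"
      unfolding set_lebesgue_integral_def
      using integrable_mult_indicator[OF _ int_c, of "A \<inter> D"]
        integrable_mult_indicator[OF _ integrable_abs[OF int_c], of A]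
      by (intro integral_mono integrable_abs) (auto simp: indicator_def)
    finally show ?thesis
      unfolding eq using h_small \<open>\<epsilon> > 0\<close> by simp
  qed
  with \<open>k > n\<close> B show ?thesis
    by (intro that[of k B]) (auto simp: B_def)
qed

text \<open>Repeated halving keeps the error \<epsilon>: each step halves the old error and adds a
  new one of at most \<epsilon>/2.\<close>

lemma infinitely_refining_dyadic:
  assumes "prob_space M" and filt: "discrete_filtration M F" and "infinitely_refining M F"
    and A: "A \<in> sets (F n)" and "\<epsilon> > 0"
  shows "\<exists>k>n. \<exists>B\<in>sets (F k). B \<subseteq> A \<and>
    (\<forall>D\<in>sets (F n). \<bar>measure M (B \<inter> D) - (1/2) ^ r * measure M (A \<inter> D)\<bar> \<le> \<epsilon>)"
  using \<open>\<epsilon> > 0\<close>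
proof (induction r arbitrary: \<epsilon>)
  case 0
  have "A \<in> sets (F (Suc n))"
    using A filtration_mono[OF filt, of n "Suc n"] by auto
  with 0 show ?case by (intro exI[of _ "Suc n"]) auto
next
  case (Suc r)
  obtain k B where k: "k > n" "B \<in> sets (F k)" "B \<subseteq> A"
    and B: "\<forall>D\<in>sets (F n). \<bar>measure M (B \<inter> D) - (1/2) ^ r * measure M (A \<inter> D)\<bar> \<le> \<epsilon>"
    using Suc.IH[OF Suc.prems] by blast
  obtain k' B' where k': "k' > k" "B' \<in> sets (F k')" "B' \<subseteq> B"
    and B': "\<And>D. D \<in> sets (F k) \<Longrightarrow> \<bar>measure M (B' \<inter> D) - measure M (B \<inter> D) / 2\<bar> \<le> \<epsilon> / 2"
    using infinitely_refining_halve[OF assms(1-3) k(2) half_gt_zero[OF Suc.prems]] by blast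
  have "\<bar>measure M (B' \<inter> D) - (1/2) ^ Suc r * measure M (A \<inter> D)\<bar> \<le> \<epsilon>" if "D \<in> sets (F n)" for D
  proof -
    have "D \<in> sets (F k)"
      using that filtration_mono[OF filt, of n k] k by auto
    moreover have "(1/2) ^ Suc r * measure M (A \<inter> D) = (1/2) ^ r * measure M (A \<inter> D) / 2"
      by simp
    ultimately show ?thesis
      using bspec[OF B that] B'[of D] by linarith
  qed
  with k k' show ?case
    by (intro exI[of _ k'] conjI bexI[of _ B']) auto
qed

text \<open>Removing a set \<open>B\<close> of relative mass about \<delta> could leave too much
  where its conditional probability is small. So only the F_n-measurable part \<open>G\<close> of
  \<open>A\<close> with conditional probability of \<open>B\<close> at least \<delta> - \<epsilon>
  is kept, and the new event is \<open>G - B\<close>. This gives the upper bound on every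
  \<open>D\<close>; a Chebyshev-type estimate shows that discarding \<open>A - G\<close> costs
  little mass.\<close>

lemma infinitely_refining_thin:
  fixes r :: nat and M :: "'a measure"
  defines "\<delta> \<equiv> (1/2) ^ r :: real"
  assumes "prob_space M" and filt: "discrete_filtration M F" and "infinitely_refining M F"
    and A: "A \<in> sets (F n)" and A0: "measure M A > 0" and \<epsilon>: "\<epsilon> > 0"
  shows "\<exists>k>n. \<exists>B\<in>sets (F k). B \<subseteq> A \<and>
    (\<forall>D\<in>sets (F n). measure M (B \<inter> D) \<le> (1 - \<delta> + \<epsilon>) * measure M (A \<inter> D)) \<and>
    (1 - \<delta> - \<epsilon>) * measure M A \<le> measure M B"
proof -
  interpret prob_space M by fact
  interpret cond: sigma_finite_subalgebra M "F i" for i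
    using assms(2,3) by (rule sigma_finite_subalgebra_filtration)
  have FM: "X \<in> sets M" if "X \<in> sets (F m)" for X m
    using that cond.subalg[of m] by (auto simp: subalgebra_def)
  \<comment> \<open>The total loss has two sources: \<eta> from the mass of \<open>B\<close> and
    \<eta>/\<epsilon> from discarding \<open>A - G\<close>. The choice makes them add up to
    \<epsilon> times the mass of \<open>A\<close>.\<close>
  define \<eta> where "\<eta> = \<epsilon> * measure M A / (1 + 1 / \<epsilon>)"
  have \<eta>: "\<eta> > 0" and \<eta>_eq: "\<eta> + \<eta> / \<epsilon> = \<epsilon> * measure M A"
  proof -
    show "\<eta> > 0" using \<epsilon> A0 unfolding \<eta>_def by (intro divide_pos_pos mult_pos_pos add_pos_pos) auto
    have "\<eta> + \<eta> / \<epsilon> = \<eta> * (1 + 1 / \<epsilon>)" by (simp add: algebra_simps)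
    also have "1 + 1 / \<epsilon> > 0" using \<epsilon> by (intro add_pos_pos) auto
    then have "\<eta> * (1 + 1 / \<epsilon>) = \<epsilon> * measure M A" by (simp add: \<eta>_def)
    finally show "\<eta> + \<eta> / \<epsilon> = \<epsilon> * measure M A" .
  qed
  obtain k B where k: "k > n" "B \<in> sets (F k)" "B \<subseteq> A"
    and B: "\<forall>D\<in>sets (F n). \<bar>measure M (B \<inter> D) - \<delta> * measure M (A \<inter> D)\<bar> \<le> \<eta>"
    using infinitely_refining_dyadic[OF assms(2-4) A \<eta>, of r] unfolding \<delta>_def by blast
  define c where "c = real_cond_exp M (F n) (indicator B)"
  define G where "G = {x \<in> A. \<delta> - \<epsilon> \<le> c x}"
  have [measurable]: "c \<in> borel_measurable (F n)"
    by (simp add: c_def)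
  have G: "G \<in> sets (F n)"
    unfolding G_def using A by measurable
  note [measurable] = FM[OF A] FM[OF k(2)] FM[OF G]
  have int_ind: "integrable M (indicator X :: 'a \<Rightarrow> real)" if "X \<in> sets M" for X
    using that by (intro integrable_real_indicator) (auto simp: less_top[symmetric])
  have int_B: "integrable M (indicator B :: 'a \<Rightarrow> real)"
    by (intro int_ind) measurable
  have int_c: "integrable M c"
    unfolding c_def using int_B by (rule cond.real_cond_exp_int)
  have meas_B: "measure M (B \<inter> D) = (\<integral>x. indicator D x * c x \<partial>M)"
    and int_D: "integrable M (\<lambda>x. indicator D x * c x)" if D: "D \<in> sets (F n)" for D
  proof -
    note [measurable] = FM[OF D]
    have "measure M (B \<inter> D) = (\<integral>x\<in>D. indicator B x \<partial>M)"
      unfolding set_lebesgue_integral_def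
      by (simp flip: indicator_inter_arith add: Int_commute)
    also have "\<dots> = (\<integral>x\<in>D. c x \<partial>M)"
      unfolding c_def using int_B D by (rule cond.real_cond_exp_intA)
    finally show "measure M (B \<inter> D) = (\<integral>x. indicator D x * c x \<partial>M)"
      by (simp add: set_lebesgue_integral_def)
    show "integrable M (\<lambda>x. indicator D x * c x)"
      using integrable_mult_indicator[OF _ int_c, of D] by simp
  qed
  have lower: "(\<delta> - \<epsilon>) * measure M D \<le> measure M (B \<inter> D)"
    if D: "D \<in> sets (F n)" "D \<subseteq> G" for D
  proof -
    note [measurable] = FM[OF D(1)]
    have "(\<delta> - \<epsilon>) * measure M D = (\<integral>x. indicator D x * (\<delta> - \<epsilon>) \<partial>M)"
      by simp
    also have "\<dots> \<le> (\<integral>x. indicator D x * c x \<partial>M)"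
      using D int_D[OF D(1)] int_ind[OF FM[OF D(1)]]
      by (intro integral_mono integrable_mult_left) (auto simp: G_def split: split_indicator)
    finally show ?thesis
      using meas_B[OF D(1)] by simp
  qed
  have upper: "measure M (B \<inter> D) \<le> (\<delta> - \<epsilon>) * measure M D"
    if D: "D \<in> sets (F n)" "D \<subseteq> A - G" for D
  proof -
    note [measurable] = FM[OF D(1)]
    have "(\<integral>x. indicator D x * c x \<partial>M) \<le> (\<integral>x. indicator D x * (\<delta> - \<epsilon>) \<partial>M)"
      using D int_D[OF D(1)] int_ind[OF FM[OF D(1)]]
      by (intro integral_mono integrable_mult_left) (auto simp: G_def split: split_indicator)
    also have "\<dots> = (\<delta> - \<epsilon>) * measure M D"
      by simp
    finally show ?thesis
      using meas_B[OF D(1)] by simp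
  qed
  have \<delta>1: "\<delta> \<le> 1" by (simp add: \<delta>_def power_le_one)
  have "measure M ((G - B) \<inter> D) \<le> (1 - \<delta> + \<epsilon>) * measure M (A \<inter> D)" if D: "D \<in> sets (F n)" for D
  proof -
    note [measurable] = FM[OF D]
    have "measure M ((G - B) \<inter> D) = measure M (G \<inter> D - B \<inter> (G \<inter> D))"
      by (rule arg_cong[where f = "measure M"]) auto
    also have "\<dots> = measure M (G \<inter> D) - measure M (B \<inter> (G \<inter> D))"
      by (rule finite_measure_Diff) auto
    also have "\<dots> \<le> (1 - \<delta> + \<epsilon>) * measure M (G \<inter> D)"
      using lower[of "G \<inter> D"] G D by (simp add: algebra_simps)
    also have "\<dots> \<le> (1 - \<delta> + \<epsilon>) * measure M (A \<inter> D)"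
      using \<delta>1 \<epsilon> by (intro mult_left_mono finite_measure_mono) (auto simp: G_def)
    finally show ?thesis .
  qed
  moreover have "(1 - \<delta> - \<epsilon>) * measure M A \<le> measure M (G - B)"
  proof -
    have AG: "A - G \<in> sets (F n)" using A G by auto
    have "A \<inter> (A - G) = A - G" by auto
    \<comment> \<open>On \<open>A - G\<close> the mass of \<open>B\<close> falls short of its target
      by at least \<epsilon> times the mass of \<open>A - G\<close>, while the dyadic approximation
      allows a deviation of at most \<eta>.\<close>
    then have "\<epsilon> * measure M (A - G) \<le> \<eta>"
      using upper[OF AG] bspec[OF B AG] by (simp add: algebra_simps)
    then have 1: "measure M (A - G) \<le> \<eta> / \<epsilon>"
      using \<epsilon> by (simp add: field_simps)
    have "B \<inter> A = B" using k by auto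
    then have 2: "measure M B \<le> \<delta> * measure M A + \<eta>"
      using bspec[OF B A] by simp
    have "measure M (A - G) = measure M A - measure M G"
    proof (rule finite_measure_Diff)
      show "G \<subseteq> A" by (auto simp: G_def)
    qed auto
    moreover have "measure M G \<le> measure M ((G - B) \<union> B)"
      by (intro finite_measure_mono) auto
    moreover have "measure M ((G - B) \<union> B) \<le> measure M (G - B) + measure M B"
      by (intro measure_Un_le) auto
    ultimately show ?thesis
      using 1 2 \<eta>_eq by (simp add: algebra_simps)
  qed
  moreover have "G - B \<in> sets (F k)"
    using G k filtration_mono[OF filt, of n k] by auto
  ultimately show ?thesis
    using k by (intro exI[of _ k] conjI bexI[of _ "G - B"]) (auto simp: G_def)
qed

text \<open>Dependent choice on pairs of a time and an event known at that time. Positive mass is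
  carried along since the next thinning requires it; it persists because 1 - \<delta> - \<epsilon> >
  0.\<close>

lemma infinitely_refining_chain:
  fixes r :: nat and M :: "'a measure"
  defines "\<delta> \<equiv> (1/2) ^ r :: real"
  assumes "prob_space M" and filt: "discrete_filtration M F" and "infinitely_refining M F"
    and \<epsilon>: "\<epsilon> > 0" "1 - \<delta> - \<epsilon> > 0"
  obtains t :: "nat \<Rightarrow> nat" and G :: "nat \<Rightarrow> 'a set" where
    "strict_mono t" "G 0 = space M" "\<And>j. G j \<in> sets (F (t j))" "\<And>j. G (Suc j) \<subseteq> G j"
    "\<And>j. measure M (G j) > 0"
    "\<And>j D. D \<in> sets (F (t j)) \<Longrightarrow> measure M (G (Suc j) \<inter> D) \<le> (1 - \<delta> + \<epsilon>) * measure M (G j \<inter> D)"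
    "\<And>j. (1 - \<delta> - \<epsilon>) * measure M (G j) \<le> measure M (G (Suc j))"
proof -
  interpret prob_space M by fact
  define P where "P = (\<lambda>j (n, A). A \<in> sets (F n) \<and> measure M A > 0 \<and> (j = (0::nat) \<longrightarrow> A = space M))"
  define Q where "Q = (\<lambda>(j::nat) (n, A) (k, B). k > n \<and> B \<subseteq> A \<and>
    (\<forall>D\<in>sets (F n). measure M (B \<inter> D) \<le> (1 - \<delta> + \<epsilon>) * measure M (A \<inter> D)) \<and>
    (1 - \<delta> - \<epsilon>) * measure M A \<le> measure M B)"
  have "\<exists>z. \<forall>j. P j (z j) \<and> Q j (z j) (z (Suc j))"
  proof (rule dependent_nat_choice)
    show "\<exists>x. P 0 x"
      using filt by (intro exI[of _ "(0, space M)"]) (auto simp: P_def discrete_filtration_def prob_space)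
  next
    fix x j assume "P j x"
    then obtain n A where x: "x = (n, A)" and A: "A \<in> sets (F n)" "measure M A > 0"
      by (auto simp: P_def)
    from infinitely_refining_thin[OF assms(2-4) A \<epsilon>(1), of r]
    obtain k B where "k > n" "B \<in> sets (F k)" "B \<subseteq> A"
      and "\<forall>D\<in>sets (F n). measure M (B \<inter> D) \<le> (1 - \<delta> + \<epsilon>) * measure M (A \<inter> D)"
      and le: "(1 - \<delta> - \<epsilon>) * measure M A \<le> measure M B"
      unfolding \<delta>_def by blast
    moreover have "measure M B > 0"
      using le mult_pos_pos[OF \<epsilon>(2) A(2)] by linarith
    ultimately show "\<exists>y. P (Suc j) y \<and> Q j x y"
      by (intro exI[of _ "(k, B)"]) (auto simp: P_def Q_def x)
  qed
  then obtain z where z: "\<And>j. P j (z j)" "\<And>j. Q j (z j) (z (Suc j))" by blast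
  show ?thesis
  proof (rule that[of "fst \<circ> z" "snd \<circ> z"])
    show "strict_mono (fst \<circ> z)"
      using z(2) by (auto simp: strict_mono_Suc_iff Q_def case_prod_unfold)
  qed (use z in \<open>auto simp: P_def Q_def case_prod_unfold\<close>)
qed

text \<open>Test the hypothesis on the set where the conditional expectation exceeds
  \<open>C\<close>. If that set were not null, the integrals over it would compare strictly, because
  the integral of \<open>C\<close> is finite, contradicting the hypothesis.\<close>

lemma (in sigma_finite_subalgebra) nn_cond_exp_le_const:
  assumes "finite_measure M" and [measurable]: "g \<in> borel_measurable M" and "C \<noteq> \<infinity>"
    and le: "\<And>D. D \<in> sets F \<Longrightarrow> (\<integral>\<^sup>+x. indicator D x * g x \<partial>M) \<le> C * emeasure M D"
  shows "AE x in M. nn_cond_exp M F g x \<le> C"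
proof (rule ccontr)
  assume neg: "\<not> ?thesis"
  interpret finite_measure M by fact
  define D where "D = {x \<in> space F. C < nn_cond_exp M F g x}"
  have D: "D \<in> sets F" unfolding D_def by measurable
  then have [measurable]: "D \<in> sets M" using subalg by (auto simp: subalgebra_def)
  have sp: "space F = space M" using subalg by (simp add: subalgebra_def)
  have "(\<integral>\<^sup>+x. indicator D x * C \<partial>M) < (\<integral>\<^sup>+x. indicator D x * nn_cond_exp M F g x \<partial>M)"
  proof (rule nn_integral_less)
    show "(\<integral>\<^sup>+x. indicator D x * C \<partial>M) \<noteq> \<infinity>"
      using \<open>C \<noteq> \<infinity>\<close> by (simp add: nn_integral_multc ennreal_mult_eq_top_iff)
    show "AE x in M. indicator D x * C \<le> indicator D x * nn_cond_exp M F g x"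
      by (auto simp: D_def indicator_def)
    show "\<not> (AE x in M. indicator D x * nn_cond_exp M F g x \<le> indicator D x * C)"
    proof
      assume "AE x in M. indicator D x * nn_cond_exp M F g x \<le> indicator D x * C"
      then have "AE x in M. nn_cond_exp M F g x \<le> C"
        using AE_space by eventually_elim (rule ccontr, simp add: D_def sp)
      with neg show False by simp
    qed
  qed auto
  also have "\<dots> = (\<integral>\<^sup>+x. indicator D x * g x \<partial>M)"
    using D by (intro nn_cond_exp_intg) auto
  also have "\<dots> \<le> C * emeasure M D" by (rule le[OF D])
  also have "\<dots> = (\<integral>\<^sup>+x. indicator D x * C \<partial>M)"
    by (subst nn_integral_multc) (auto simp: mult.commute)
  finally show False by simp
qed

section \<open>Extremal functions along a chain of events\<close>

text \<open>The two retention ratios have separate uses: \<open>q'\<close> bounds every portion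
  known at time \<open>t j\<close> and gives the Carleson constant, while \<open>q\<close> bounds
  total masses only and serves the estimates of the test function.\<close>

locale refining_chain = prob_space M for M :: "'a measure" +
  fixes F :: "nat \<Rightarrow> 'a measure" and t :: "nat \<Rightarrow> nat" and G :: "nat \<Rightarrow> 'a set"
    and q q' :: real
  assumes filt: "discrete_filtration M F"
    and mono_t: "strict_mono t"
    and G_0: "G 0 = space M"
    and G_sets: "\<And>j. G j \<in> sets (F (t j))"
    and G_Suc: "\<And>j. G (Suc j) \<subseteq> G j"
    and G_pos: "\<And>j. measure M (G j) > 0"
    and q': "0 \<le> q'" "q' < 1"
    and upper: "\<And>j D. D \<in> sets (F (t j)) \<Longrightarrow> measure M (G (Suc j) \<inter> D) \<le> q' * measure M (G j \<inter> D)"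
    and q: "0 < q"
    and lower: "\<And>j. q * measure M (G j) \<le> measure M (G (Suc j))"
begin

sublocale cond: sigma_finite_subalgebra M "F i" for i
  using prob_space_axioms filt by (rule sigma_finite_subalgebra_filtration)

lemma F_sets_M: "X \<in> sets (F i) \<Longrightarrow> X \<in> sets M"
  using cond.subalg[of i] by (auto simp: subalgebra_def)

lemma G_meas [measurable]: "G j \<in> sets M"
  using G_sets by (rule F_sets_M)

lemma G_antimono: "i \<le> j \<Longrightarrow> G j \<subseteq> G i"
  using G_Suc by (rule lift_Suc_antimono_le)

lemma integrable_indicator_M: "X \<in> sets M \<Longrightarrow> integrable M (indicator X :: 'a \<Rightarrow> real)"
  by (intro integrable_real_indicator) (auto simp: less_top[symmetric])

section \<open>The indicators of the chain as a Carleson sequence\<close>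

definition weight :: "nat \<Rightarrow> 'a \<Rightarrow> real" where
  "weight n x = (if n \<in> range t then indicator (G (inv t n)) x else 0)"

lemma weight_t [simp]: "weight (t j) = indicator (G j)"
  using mono_t by (auto simp: weight_def strict_mono_imp_inj_on inv_f_f fun_eq_iff)

lemma weight_notin_range: "n \<notin> range t \<Longrightarrow> weight n x = 0"
  by (simp add: weight_def)

lemma weight_measurable: "weight n \<in> borel_measurable (F n)"
proof (cases "n \<in> range t")
  case True
  then obtain j where "n = t j" by auto
  then show ?thesis using G_sets[of j] by simp
qed (simp add: weight_def[abs_def])

lemma weight_nonneg: "0 \<le> weight n x"
  by (simp add: weight_def)

text \<open>For D in F_n let \<open>j0\<close> be the first index with n \<le> t j0. From there on
  \<open>D\<close> is known at every chain time, so the masses of G_j within \<open>D\<close> decay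
  geometrically with ratio \<open>q'\<close>, and the series sums to 1 / (1 - q').\<close>

lemma carleson_weight: "carleson_seq M F weight (1 / (1 - q'))"
proof -
  have [measurable]: "weight n \<in> borel_measurable M" for n
    by (rule measurable_from_subalg[OF cond.subalg weight_measurable])
  have "AE x in M. nn_cond_exp M (F n) (\<lambda>y. \<Sum>k. ennreal (weight (n + k) y)) x \<le> ennreal (1 / (1 - q'))" for n
  proof (rule cond.nn_cond_exp_le_const)
    fix D assume D: "D \<in> sets (F n)"
    note [measurable] = F_sets_M[OF D]
    define u where "u = (\<lambda>m. \<integral>\<^sup>+x. indicator D x * ennreal (weight m x) \<partial>M)"
    have u_t: "u (t j) = ennreal (measure M (G j \<inter> D))" for j
    proof -
      have "u (t j) = (\<integral>\<^sup>+x. indicator (G j \<inter> D) x \<partial>M)"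
        unfolding u_def by (intro nn_integral_cong) (auto split: split_indicator)
      then show ?thesis by (simp add: emeasure_eq_measure)
    qed
    have u_0: "u m = 0" if "m \<notin> range t" for m
      using that by (simp add: u_def weight_notin_range)
    define j0 where "j0 = (LEAST j. n \<le> t j)"
    have j0: "n \<le> t j0"
      unfolding j0_def by (rule LeastI[of _ n]) (rule strict_mono_imp_increasing[OF mono_t])
    have j0_le: "j0 \<le> j" if "n \<le> t j" for j
      unfolding j0_def using that by (rule Least_le)
    have t_ge: "n \<le> t (j0 + i)" for i
      using j0 strict_mono_less_eq[OF mono_t, of j0 "j0 + i"] by simp
    have geom: "measure M (G (j0 + i) \<inter> D) \<le> q' ^ i * measure M D" for i
    proof (induction i)
      case 0
      show ?case by (auto intro!: finite_measure_mono)
    next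
      case (Suc i)
      have "D \<in> sets (F (t (j0 + i)))"
        using D filtration_mono[OF filt t_ge[of i]] by auto
      then have "measure M (G (j0 + Suc i) \<inter> D) \<le> q' * measure M (G (j0 + i) \<inter> D)"
        using upper[of D "j0 + i"] by simp
      also have "\<dots> \<le> q' * (q' ^ i * measure M D)"
        using q' Suc by (intro mult_left_mono) auto
      finally show ?case by simp
    qed
    have "(\<integral>\<^sup>+x. indicator D x * (\<Sum>k. ennreal (weight (n + k) x)) \<partial>M)
        = (\<integral>\<^sup>+x. (\<Sum>k. indicator D x * ennreal (weight (n + k) x)) \<partial>M)"
      by simp
    also have "\<dots> = (\<Sum>k. u (n + k))"
      unfolding u_def by (rule nn_integral_suminf) measurable
    \<comment> \<open>Only chain times carry weight, and those from \<open>n\<close> on are exactly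
      t (j0 + i).\<close>
    also have "\<dots> = (\<Sum>i. u (n + (t (j0 + i) - n)))"
    proof (rule suminf_mono_reindex[symmetric])
      show "strict_mono (\<lambda>i. t (j0 + i) - n)"
      proof (rule strict_monoI)
        fix a b :: nat assume "a < b"
        then have "t (j0 + a) < t (j0 + b)"
          using mono_t by (simp add: strict_mono_def)
        with t_ge[of a] show "t (j0 + a) - n < t (j0 + b) - n" by simp
      qed
      fix k assume k: "k \<notin> range (\<lambda>i. t (j0 + i) - n)"
      have "n + k \<noteq> t j" for j
      proof
        assume eq: "n + k = t j"
        then have "j0 \<le> j" by (intro j0_le) simp
        with eq have "k = t (j0 + (j - j0)) - n" by simp
        with k show False by blast
      qed
      then show "u (n + k) = 0"
        by (intro u_0) auto
    qed
    also have "\<dots> = (\<Sum>i. ennreal (measure M (G (j0 + i) \<inter> D)))"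
      using t_ge by (simp add: u_t)
    also have "\<dots> \<le> (\<Sum>i. ennreal (q' ^ i * measure M D))"
      using geom by (intro suminf_le ennreal_leI) auto
    also have "\<dots> = ennreal (\<Sum>i. q' ^ i * measure M D)"
      using q' by (intro suminf_ennreal2 summable_mult2) auto
    also have "(\<Sum>i. q' ^ i * measure M D) = 1 / (1 - q') * measure M D"
      using q' by (subst suminf_mult2[symmetric]) (auto simp: suminf_geometric)
    also have "ennreal \<dots> = ennreal (1 / (1 - q')) * emeasure M D"
      using q' by (subst ennreal_mult) (auto simp: emeasure_eq_measure)
    finally show "(\<integral>\<^sup>+x. indicator D x * (\<Sum>k. ennreal (weight (n + k) x)) \<partial>M)
        \<le> ennreal (1 / (1 - q')) * emeasure M D" .
  qed (auto simp: finite_measure_axioms)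
  then have "AE x in M. enn2ereal (nn_cond_exp M (F n) (\<lambda>y. \<Sum>k. ennreal (weight (n + k) y)) x)
      \<le> ereal (1 / (1 - q'))" for n
    using q' by (simp add: less_eq_ennreal.rep_eq)
  then show ?thesis
    by (simp add: carleson_seq_def weight_measurable weight_nonneg)
qed

text \<open>A discrete x^(-1/p), cut off on \<open>G N\<close>. There the value is the mean of
  x^(-1/p) over the interval from 0 to the mass of \<open>G N\<close>, whence the factor p / (p -
  1): the cut-off keeps the averages large and the p-th power integrable.\<close>

definition test_fun :: "real \<Rightarrow> nat \<Rightarrow> 'a \<Rightarrow> real" where
  "test_fun p N x = (\<Sum>i<N. measure M (G i) powr (-1/p) * (indicator (G i) x - indicator (G (Suc i)) x))
    + p / (p - 1) * measure M (G N) powr (-1/p) * indicator (G N) x"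

text \<open>The pieces are disjoint, so the power acts termwise. In the induction a point inside
  \<open>G (Suc N)\<close> does not see the last difference; for a point outside, that difference is
  the plateau of stage \<open>N\<close> with height \<open>a N\<close>, which is why
  \<open>b\<close> is generalized.\<close>

lemma abs_step_fun_powr:
  fixes a :: "nat \<Rightarrow> real" and p :: real
  assumes "p > 0" "\<And>i. 0 \<le> a i" "0 \<le> b"
  shows "\<bar>(\<Sum>i<N. a i * (indicator (G i) x - indicator (G (Suc i)) x)) + b * indicator (G N) x\<bar> powr p
    = (\<Sum>i<N. a i powr p * (indicator (G i) x - indicator (G (Suc i)) x)) + b powr p * indicator (G N) x"
  using \<open>0 \<le> b\<close>
proof (induction N arbitrary: b)
  case 0
  then show ?case using assms by (auto split: split_indicator)
next
  case (Suc N)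
  show ?case
  proof (cases "x \<in> G (Suc N)")
    case True
    then have "x \<in> G N" using G_Suc by auto
    with True Suc.IH[OF Suc.prems] show ?thesis by simp
  next
    case False
    with Suc.IH[of "a N"] assms show ?thesis by simp
  qed
qed

lemma test_fun_measurable [measurable]: "test_fun p N \<in> borel_measurable M"
  unfolding test_fun_def by measurable

lemma integrable_test_fun: "integrable M (test_fun p N)"
  unfolding test_fun_def
  by (intro Bochner_Integration.integrable_add Bochner_Integration.integrable_sum integrable_mult_right
      Bochner_Integration.integrable_diff integrable_indicator_M) measurable

text \<open>The p-th power on the i-th difference is the reciprocal of the mass of
  \<open>G i\<close>, and the difference has at most the fraction 1 - q of that mass. So each of the
  \<open>N\<close> pieces contributes at most 1 - q.\<close>

lemma test_fun_powr:
  assumes p: "p > 1"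
  shows "integrable M (\<lambda>x. \<bar>test_fun p N x\<bar> powr p)"
    and "(\<integral>x. \<bar>test_fun p N x\<bar> powr p \<partial>M) \<le> real N * (1 - q) + (p / (p - 1)) powr p"
proof -
  define m where "m = (\<lambda>i. measure M (G i))"
  have m: "m i > 0" "q * m i \<le> m (Suc i)" for i
    using G_pos lower by (auto simp: m_def)
  have m_powr: "(m i powr (-1/p)) powr p = 1 / m i" for i
    using p m(1)[of i] by (simp add: powr_powr powr_neg_one)
  have eq: "\<bar>test_fun p N x\<bar> powr p = (\<Sum>i<N. (1 / m i) * (indicator (G i) x - indicator (G (Suc i)) x))
      + ((p / (p - 1)) powr p / m N) * indicator (G N) x" for x
  proof -
    have tail: "(p / (p - 1) * m N powr (-1/p)) powr p = (p / (p - 1)) powr p / m N"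
      using p m_powr[of N]
      by (simp add: powr_mult del: times_divide_eq_right times_divide_eq_left) simp
    have "test_fun p N x = (\<Sum>i<N. m i powr (-1/p) * (indicator (G i) x - indicator (G (Suc i)) x))
        + p / (p - 1) * m N powr (-1/p) * indicator (G N) x"
      by (simp add: test_fun_def m_def)
    also have "\<bar>\<dots>\<bar> powr p = (\<Sum>i<N. (m i powr (-1/p)) powr p * (indicator (G i) x - indicator (G (Suc i)) x))
        + (p / (p - 1) * m N powr (-1/p)) powr p * indicator (G N) x"
      using p by (intro abs_step_fun_powr) auto
    finally show ?thesis by (simp only: m_powr tail)
  qed
  show "integrable M (\<lambda>x. \<bar>test_fun p N x\<bar> powr p)"
    unfolding eq
    by (intro Bochner_Integration.integrable_add Bochner_Integration.integrable_sum integrable_mult_right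
      Bochner_Integration.integrable_diff integrable_indicator_M) measurable
  have "(\<integral>x. \<bar>test_fun p N x\<bar> powr p \<partial>M) = (\<Sum>i<N. (1 / m i) * (m i - m (Suc i)))
      + ((p / (p - 1)) powr p / m N) * m N"
    unfolding eq
    by (simp add: integrable_indicator_M m_def Bochner_Integration.integral_add
      Bochner_Integration.integral_sum Bochner_Integration.integral_diff)
  also have "\<dots> \<le> (\<Sum>i<N. 1 - q) + (p / (p - 1)) powr p"
  proof (intro add_mono sum_mono)
    fix i
    have "m i - m (Suc i) \<le> (1 - q) * m i" using m(2)[of i] by (simp add: algebra_simps)
    then show "(1 / m i) * (m i - m (Suc i)) \<le> 1 - q"
      using m(1)[of i] by (simp add: field_simps)
  qed (use m(1)[of N] in simp)
  finally show "(\<integral>x. \<bar>test_fun p N x\<bar> powr p \<partial>M) \<le> real N * (1 - q) + (p / (p - 1)) powr p"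
    by simp
qed

lemma q_le_1: "q \<le> 1"
proof -
  have "q \<le> measure M (G (Suc 0))"
    using lower[of 0] by (simp add: G_0 prob_space)
  also have "\<dots> \<le> 1" by (rule prob_le_1)
  finally show ?thesis .
qed

text \<open>A Riemann-sum comparison: over \<open>G j\<close> only the pieces from \<open>j\<close>
  on matter, and each dominates an increment of p' x^(1 - 1/p) up to the factor q^(1/p). The
  increments telescope.\<close>

lemma integral_test_fun_ge:
  assumes p: "p > 1" and j: "j \<le> N"
  shows "q powr (1/p) * (p / (p - 1)) * measure M (G j) powr (1 - 1/p)
    \<le> (\<integral>x. indicator (G j) x * test_fun p N x \<partial>M)"
proof -
  define m where "m = (\<lambda>i. measure M (G i))"
  define s where "s = 1 - 1/p"
  define \<kappa> where "\<kappa> = q powr (1/p) * (p / (p - 1))"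
  have m: "m i > 0" "q * m i \<le> m (Suc i)" "m (Suc i) \<le> m i" for i
    using G_pos lower G_Suc by (auto simp: m_def intro!: finite_measure_mono)
  have int: "(\<integral>x. indicator (G j) x * test_fun p N x \<partial>M)
    = (\<Sum>i<N. m i powr (-1/p) * (measure M (G i \<inter> G j) - measure M (G (Suc i) \<inter> G j)))
      + p / (p - 1) * m N powr (-1/p) * measure M (G N \<inter> G j)"
  proof -
    have "indicator (G j) x * test_fun p N x
      = (\<Sum>i<N. m i powr (-1/p) * (indicator (G i \<inter> G j) x - indicator (G (Suc i) \<inter> G j) x))
      + p / (p - 1) * m N powr (-1/p) * indicator (G N \<inter> G j) x" for x
      by (simp add: test_fun_def m_def indicator_inter_arith algebra_simps sum_distrib_left)
    then show ?thesis
      by (simp add: integrable_indicator_M Bochner_Integration.integral_add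
      Bochner_Integration.integral_sum Bochner_Integration.integral_diff)
  qed
  \<comment> \<open>The tangent bound has its slope at the smaller mass m (Suc i), but the test
    function uses m i. Their ratio is at least \<open>q\<close>, which costs exactly
    q^(1/p).\<close>
  have "\<kappa> * (m i powr s - m (Suc i) powr s) \<le> m i powr (-1/p) * (m i - m (Suc i))" for i
  proof -
    have "q powr (1/p) * (p / (p - 1) * (m i powr s - m (Suc i) powr s))
        \<le> q powr (1/p) * (m (Suc i) powr (-1/p) * (m i - m (Suc i)))"
      unfolding s_def using p m by (intro mult_left_mono powr_diff_le_concave) auto
    also have "\<dots> \<le> q powr (1/p) * ((q * m i) powr (-1/p) * (m i - m (Suc i)))"
      using p q m[of i] by (intro mult_left_mono mult_right_mono powr_mono2') auto
    also have "\<dots> = m i powr (-1/p) * (m i - m (Suc i))"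
      using q m[of i] by (simp add: powr_mult powr_minus field_simps)
    finally show ?thesis by (simp add: \<kappa>_def mult.assoc)
  qed
  then have "(\<Sum>i=j..<N. \<kappa> * (m i powr s - m (Suc i) powr s)) \<le> (\<Sum>i=j..<N. m i powr (-1/p) * (m i - m (Suc i)))"
    by (intro sum_mono)
  also have "(\<Sum>i=j..<N. \<kappa> * (m i powr s - m (Suc i) powr s)) = \<kappa> * (m j powr s - m N powr s)"
    using sum_Suc_diff'[OF j, of "\<lambda>i. - (m i powr s)"] by (simp add: sum_distrib_left[symmetric])
  also have "(\<Sum>i=j..<N. m i powr (-1/p) * (m i - m (Suc i)))
      = (\<Sum>i<N. m i powr (-1/p) * (measure M (G i \<inter> G j) - measure M (G (Suc i) \<inter> G j)))"
  proof (rule sum.mono_neutral_cong_left)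
    show "\<forall>i\<in>{..<N} - {j..<N}. m i powr (-1/p) * (measure M (G i \<inter> G j) - measure M (G (Suc i) \<inter> G j)) = 0"
    proof
      fix i assume "i \<in> {..<N} - {j..<N}"
      then have "G i \<inter> G j = G j" "G (Suc i) \<inter> G j = G j"
        using G_antimono[of i j] G_antimono[of "Suc i" j] by auto
      then show "m i powr (-1/p) * (measure M (G i \<inter> G j) - measure M (G (Suc i) \<inter> G j)) = 0" by simp
    qed
    fix i assume "i \<in> {j..<N}"
    then have "G i \<inter> G j = G i" "G (Suc i) \<inter> G j = G (Suc i)"
      using G_antimono[of j i] G_antimono[of j "Suc i"] by auto
    then show "m i powr (-1/p) * (m i - m (Suc i))
        = m i powr (-1/p) * (measure M (G i \<inter> G j) - measure M (G (Suc i) \<inter> G j))"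
      by (simp add: m_def)
  qed auto
  finally have 1: "\<kappa> * (m j powr s - m N powr s)
    \<le> (\<Sum>i<N. m i powr (-1/p) * (measure M (G i \<inter> G j) - measure M (G (Suc i) \<inter> G j)))" .
  have "G N \<inter> G j = G N" using G_antimono[OF j] by auto
  moreover have "m N powr (-1/p) * m N = m N powr s"
    using m(1)[of N] by (simp add: s_def powr_mult_base mult.commute)
  ultimately have 2: "p / (p - 1) * m N powr (-1/p) * measure M (G N \<inter> G j) = p / (p - 1) * m N powr s"
    by (simp add: m_def mult.assoc)
  have "q powr (1/p) \<le> 1"
    using q q_le_1 p by (intro powr_le1) auto
  \<comment> \<open>The plateau on \<open>G N\<close> restores the end term subtracted by the
    telescoping, since \<kappa> \<le> p / (p - 1).\<close>
  then have "\<kappa> * m N powr s \<le> p / (p - 1) * m N powr s"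
    using p unfolding \<kappa>_def by (intro mult_right_mono mult_left_le_one_le) auto
  with 1 have "\<kappa> * m j powr s \<le> (\<integral>x. indicator (G j) x * test_fun p N x \<partial>M)"
    unfolding int 2 right_diff_distrib[of \<kappa>] by linarith
  then show ?thesis
    by (simp only: \<kappa>_def m_def s_def)
qed

text \<open>Jensen's inequality on \<^term>\<open>G j\<close>, applied through the tangent at the lower bound \<open>c\<close> for
  the mean of the test function over \<^term>\<open>G j\<close>.\<close>
lemma nn_integral_cond_exp_test_fun_ge:
  assumes p: "p > 1" and j: "j \<le> N"
  shows "ennreal (q * (p / (p - 1)) powr p)
    \<le> (\<integral>\<^sup>+x. ennreal (weight (t j) x * \<bar>real_cond_exp M (F (t j)) (test_fun p N) x\<bar> powr p) \<partial>M)"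
proof -
  define m where "m = measure M (G j)"
  define h where "h = real_cond_exp M (F (t j)) (test_fun p N)"
  define c where "c = q powr (1/p) * (p / (p - 1)) * m powr (-1/p)"
  have m: "m > 0" using G_pos by (simp add: m_def)
  have c: "0 \<le> c" using p by (simp add: c_def)
  have c_powr: "c powr p * m = q * (p / (p - 1)) powr p"
  proof -
    have "c powr p = (q powr (1/p)) powr p * (p / (p - 1)) powr p * (m powr (-1/p)) powr p"
      using p unfolding c_def by (simp add: powr_mult del: times_divide_eq_right times_divide_eq_left)
    moreover have "(q powr (1/p)) powr p = q" "(m powr (-1/p)) powr p = 1 / m"
      using p q m by (simp_all add: powr_powr powr_neg_one)
    ultimately show ?thesis using m by simp
  qed
  have cm: "c * m = q powr (1/p) * (p / (p - 1)) * m powr (1 - 1/p)"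
    using m by (simp add: c_def powr_mult_base mult.assoc mult.commute[of _ m])
  have int_h: "integrable M h"
    unfolding h_def using integrable_test_fun by (rule cond.real_cond_exp_int)
  have int_Gh: "integrable M (\<lambda>x. indicator (G j) x * h x)"
    using integrable_mult_indicator[OF _ int_h, of "G j"] by simp
  define l where "l = (\<lambda>x. p * c powr (p - 1) * (indicator (G j) x * h x) - (p - 1) * c powr p * indicator (G j) x)"
  have int_l: "integrable M l"
    unfolding l_def using int_Gh integrable_indicator_M[of "G j"]
    by (intro Bochner_Integration.integrable_diff integrable_mult_right) auto
  have "(\<integral>x. indicator (G j) x * h x \<partial>M) = (\<integral>x. indicator (G j) x * test_fun p N x \<partial>M)"
    using cond.real_cond_exp_intA[OF integrable_test_fun[of p N] G_sets[of j]]
    by (simp add: h_def set_lebesgue_integral_def)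
  then have "c * m \<le> (\<integral>x. indicator (G j) x * h x \<partial>M)"
    using integral_test_fun_ge[OF p j] unfolding m_def[symmetric] cm[symmetric] by simp
  then have "p * c powr (p - 1) * (c * m) \<le> p * c powr (p - 1) * (\<integral>x. indicator (G j) x * h x \<partial>M)"
    using p by (intro mult_left_mono) auto
  moreover have "c powr (p - 1) * c = c powr p"
    using c by (simp add: powr_mult_base mult.commute)
  then have "p * c powr (p - 1) * (c * m) = p * (c powr p * m)"
    by (metis mult.assoc)
  moreover have "(p - 1) * c powr p * m = p * (c powr p * m) - c powr p * m"
    by (simp add: algebra_simps)
  ultimately have "c powr p * m \<le> p * c powr (p - 1) * (\<integral>x. indicator (G j) x * h x \<partial>M) - (p - 1) * c powr p * m"
    by linarith
  also have "\<dots> = (\<integral>x. l x \<partial>M)"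
    unfolding l_def using int_Gh integrable_indicator_M[of "G j"]
    by (subst Bochner_Integration.integral_diff) (auto simp: m_def)
  finally have "ennreal (c powr p * m) \<le> ennreal (\<integral>x. l x \<partial>M)"
    by (rule ennreal_leI)
  \<comment> \<open>The tangent \<open>l\<close> may be negative; its positive part still lies below
    the nonnegative target and has an integral of nonnegative type.\<close>
  also have "\<dots> \<le> ennreal (\<integral>x. max 0 (l x) \<partial>M)"
    using int_l by (intro ennreal_leI integral_mono) auto
  also have "\<dots> = (\<integral>\<^sup>+x. ennreal (max 0 (l x)) \<partial>M)"
    using int_l by (intro nn_integral_eq_integral[symmetric]) auto
  also have "\<dots> \<le> (\<integral>\<^sup>+x. ennreal (weight (t j) x * \<bar>h x\<bar> powr p) \<partial>M)"
    using powr_ge_tangent[OF p c]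
    by (intro nn_integral_mono ennreal_leI) (auto simp: l_def split: split_indicator)
  finally show ?thesis
    by (simp only: c_powr h_def)
qed

text \<open>The N + 1 chain times with j \<le> N contribute equally, so the sum grows linearly in
  \<open>N\<close>, as does the bound for the p-th power of the test function.\<close>

lemma carleson_sum_test_fun_ge:
  assumes p: "p > 1"
  shows "ennreal ((real N + 1) * (q * (p / (p - 1)) powr p))
    \<le> (\<integral>\<^sup>+x. (\<Sum>n. ennreal (weight n x * \<bar>real_cond_exp M (F n) (test_fun p N) x\<bar> powr p)) \<partial>M)"
proof -
  have [measurable]: "weight n \<in> borel_measurable M" for n
    by (rule measurable_from_subalg[OF cond.subalg weight_measurable])
  define u where "u = (\<lambda>n. \<integral>\<^sup>+x. ennreal (weight n x * \<bar>real_cond_exp M (F n) (test_fun p N) x\<bar> powr p) \<partial>M)"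
  have "ennreal ((real N + 1) * (q * (p / (p - 1)) powr p)) = (\<Sum>j\<le>N. ennreal (q * (p / (p - 1)) powr p))"
    using q by (subst sum_ennreal) auto
  also have "\<dots> \<le> (\<Sum>j\<le>N. u (t j))"
    unfolding u_def by (intro sum_mono nn_integral_cond_exp_test_fun_ge p) auto
  also have "\<dots> \<le> (\<Sum>j. u (t j))"
    by (intro sum_le_suminf) auto
  also have "\<dots> = (\<Sum>n. u n)"
    by (rule suminf_mono_reindex[OF mono_t]) (simp add: u_def weight_notin_range)
  also have "\<dots> = (\<integral>\<^sup>+x. (\<Sum>n. ennreal (weight n x * \<bar>real_cond_exp M (F n) (test_fun p N) x\<bar> powr p)) \<partial>M)"
    unfolding u_def by (rule nn_integral_suminf[symmetric]) measurable
  finally show ?thesis .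
qed

end

section \<open>Sharpness and the theorem\<close>

text \<open>Write P for (p')^p. For a fixed chain the guaranteed quotient tends to q P (1 - q') / (1
  - q) as N grows, and this tends to P as \<delta> goes to 0. So first \<delta> is chosen, then
  \<open>N\<close>.\<close>

theorem carleson_embedding_sharp:
  fixes M :: "'a measure" and F :: "nat \<Rightarrow> 'a measure" and p K :: real
  assumes "prob_space M" and filt: "discrete_filtration M F" and p: "p > 1"
    and ref: "infinitely_refining M F" and K: "K < (p / (p - 1)) powr p"
  obtains f :: "'a \<Rightarrow> real" and \<alpha> C where
    "f \<in> borel_measurable M" "integrable M (\<lambda>x. \<bar>f x\<bar> powr p)" "carleson_seq M F \<alpha> C"
    "ereal (K * C * (\<integral>x. \<bar>f x\<bar> powr p \<partial>M))
      < enn2ereal (\<integral>\<^sup>+ x. (\<Sum>n. ennreal (\<alpha> n x * \<bar>real_cond_exp M (F n) f x\<bar> powr p)) \<partial>M)"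
proof -
  define P where "P = (p / (p - 1)) powr p"
  \<comment> \<open>Replacing \<open>K\<close> by a nonnegative number keeps the later
    multiplications monotone.\<close>
  define K0 where "K0 = max K 0"
  have P: "P > 0" using p by (simp add: P_def)
  have K0: "0 \<le> K0" "K \<le> K0" "K0 < P" using K P by (auto simp: K0_def P_def)
  have lim: "(\<lambda>r. (1/2) ^ r :: real) \<longlonglongrightarrow> 0"
    by (rule LIMSEQ_realpow_zero) auto
  \<comment> \<open>This is the gain per chain step divided by \<delta>; the division leaves a
    positive limit P - K0.\<close>
  have "(\<lambda>r. (1 - (1/2) ^ r - ((1/2) ^ r)\<^sup>2) * P * (1 - (1/2) ^ r) - K0 * (1 + (1/2) ^ r))
      \<longlonglongrightarrow> (1 - 0 - 0\<^sup>2) * P * (1 - 0) - K0 * (1 + 0)"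
    by (intro tendsto_intros lim)
  moreover have "0 < (1 - 0 - 0\<^sup>2) * P * (1 - 0) - K0 * (1 + 0)"
    using K0 by simp
  ultimately have "\<forall>\<^sub>F r in sequentially.
      0 < (1 - (1/2) ^ r - ((1/2) ^ r)\<^sup>2) * P * (1 - (1/2) ^ r) - K0 * (1 + (1/2) ^ r)"
    by (rule order_tendstoD)
  moreover have "\<forall>\<^sub>F r in sequentially. (1/2) ^ r < (1/2 :: real)"
    by (rule order_tendstoD[OF lim]) simp
  ultimately have "\<forall>\<^sub>F r in sequentially. (1/2) ^ r < (1/2 :: real) \<and>
      0 < (1 - (1/2) ^ r - ((1/2) ^ r)\<^sup>2) * P * (1 - (1/2) ^ r) - K0 * (1 + (1/2) ^ r)"
    by eventually_elim simp
  then obtain r :: nat where r: "(1/2) ^ r < (1/2 :: real)"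
      "0 < (1 - (1/2) ^ r - ((1/2) ^ r)\<^sup>2) * P * (1 - (1/2) ^ r) - K0 * (1 + (1/2) ^ r)"
    using eventually_happens'[OF sequentially_bot] by blast
  define \<delta> :: real where "\<delta> = (1/2) ^ r"
  \<comment> \<open>The thinning error is taken as \<delta>^2, of smaller order than the loss
    \<delta>, so that (1 - q') / (1 - q) = (1 - \<delta>) / (1 + \<delta>) tends to 1.\<close>
  define q where "q = 1 - \<delta> - \<delta>\<^sup>2"
  define q' where "q' = 1 - \<delta> + \<delta>\<^sup>2"
  have \<delta>: "0 < \<delta>" "\<delta> < 1/2" using r(1) by (simp_all add: \<delta>_def)
  have \<delta>2: "\<delta>\<^sup>2 < \<delta> / 2" "0 < \<delta>\<^sup>2"
    using \<delta> by (simp_all add: power2_eq_square)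
  have q: "0 < q" and q': "0 \<le> q'" "q' < 1"
    using \<delta> \<delta>2 unfolding q_def q'_def by linarith+
  obtain t :: "nat \<Rightarrow> nat" and G :: "nat \<Rightarrow> 'a set" where
    chain: "strict_mono t" "G 0 = space M" "\<And>j. G j \<in> sets (F (t j))" "\<And>j. G (Suc j) \<subseteq> G j"
    "\<And>j. measure M (G j) > 0"
    "\<And>j D. D \<in> sets (F (t j)) \<Longrightarrow> measure M (G (Suc j) \<inter> D) \<le> q' * measure M (G j \<inter> D)"
    "\<And>j. q * measure M (G j) \<le> measure M (G (Suc j))"
    using infinitely_refining_chain[OF assms(1) filt ref \<delta>2(2), of r] q
    unfolding q_def q'_def \<delta>_def by blast
  interpret refining_chain M F t G q q'
    using chain q q' filt assms(1)
    by (intro refining_chain.intro refining_chain_axioms.intro) auto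
  have eq: "1 - q' = \<delta> * (1 - \<delta>)" "1 - q = \<delta> * (1 + \<delta>)"
    by (simp_all add: q_def q'_def power2_eq_square algebra_simps)
  have gain: "0 < q * P * (1 - q') - K0 * (1 - q)"
  proof -
    have "0 < \<delta> * (q * P * (1 - \<delta>) - K0 * (1 + \<delta>))"
      using \<delta>(1) r(2) unfolding q_def \<delta>_def by (rule mult_pos_pos)
    then show ?thesis unfolding eq by (simp add: algebra_simps)
  qed
  \<comment> \<open>With \<open>N\<close> this large, the accumulated gain outweighs the fixed
    contribution \<open>P\<close> of the plateau.\<close>
  obtain N :: nat where "K0 * P < real N * (q * P * (1 - q') - K0 * (1 - q))"
    using reals_Archimedean3[OF gain] by blast
  moreover have "0 \<le> q * P * (1 - q')"
    using q q' P by simp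
  ultimately have N: "K0 * (real N * (1 - q) + P) < (real N + 1) * (q * P) * (1 - q')"
    by (simp add: algebra_simps)
  define I where "I = (\<integral>x. \<bar>test_fun p N x\<bar> powr p \<partial>M)"
  have I: "0 \<le> I" "I \<le> real N * (1 - q) + P"
    using test_fun_powr(2)[OF p, of N] by (simp_all add: I_def P_def)
  have "K * (1 / (1 - q')) * I = K * I / (1 - q')" by simp
  also have "\<dots> \<le> K0 * (real N * (1 - q) + P) / (1 - q')"
    using I K0 q' by (intro divide_right_mono mult_mono) auto
  also have "\<dots> < (real N + 1) * (q * P)"
    using N q' by (simp add: divide_less_eq)
  finally have less: "K * (1 / (1 - q')) * I < (real N + 1) * (q * P)" .
  have "ereal ((real N + 1) * (q * P)) = enn2ereal (ennreal ((real N + 1) * (q * P)))"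
    using q P by (subst enn2ereal_ennreal) auto
  also have "\<dots> \<le> enn2ereal (\<integral>\<^sup>+ x. (\<Sum>n. ennreal (weight n x * \<bar>real_cond_exp M (F n) (test_fun p N) x\<bar> powr p)) \<partial>M)"
    using carleson_sum_test_fun_ge[OF p, of N] by (simp add: P_def less_eq_ennreal.rep_eq)
  finally have "ereal (K * (1 / (1 - q')) * I)
      < enn2ereal (\<integral>\<^sup>+ x. (\<Sum>n. ennreal (weight n x * \<bar>real_cond_exp M (F n) (test_fun p N) x\<bar> powr p)) \<partial>M)"
    using less by (meson ereal_less(2) less_ereal.simps(1) order_less_le_trans)
  with carleson_weight test_fun_powr(1)[OF p] test_fun_measurable show ?thesis
    unfolding I_def by (intro that[of "test_fun p N" weight "1 / (1 - q')"]) auto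
qed

theorem theorem1p3:
  fixes M :: "'a measure" and F :: "nat \<Rightarrow> 'a measure" and p :: real
  assumes "prob_space M"
    and "discrete_filtration M F"
    and "p > 1"
  shows "(\<forall>(f::'a \<Rightarrow> real) \<alpha> C.
            f \<in> borel_measurable M \<longrightarrow> integrable M (\<lambda>x. \<bar>f x\<bar> powr p) \<longrightarrow>
            carleson_seq M F \<alpha> C \<longrightarrow>
            enn2ereal (\<integral>\<^sup>+ x. (\<Sum>n. ennreal (\<alpha> n x * \<bar>real_cond_exp M (F n) f x\<bar> powr p)) \<partial>M)
              \<le> ereal ((p / (p - 1)) powr p * C * (\<integral>x. \<bar>f x\<bar> powr p \<partial>M)))
       \<and> (infinitely_refining M F \<longrightarrow>
            (\<forall>K::real. K < (p / (p - 1)) powr p \<longrightarrow>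
              (\<exists>(f::'a \<Rightarrow> real) \<alpha> C.
                 f \<in> borel_measurable M \<and> integrable M (\<lambda>x. \<bar>f x\<bar> powr p) \<and>
                 carleson_seq M F \<alpha> C \<and>
                 enn2ereal (\<integral>\<^sup>+ x. (\<Sum>n. ennreal (\<alpha> n x * \<bar>real_cond_exp M (F n) f x\<bar> powr p)) \<partial>M)
                   > ereal (K * C * (\<integral>x. \<bar>f x\<bar> powr p \<partial>M)))))"
proof (intro conjI allI impI)
  fix f :: "'a \<Rightarrow> real" and \<alpha> C
  assume *: "f \<in> borel_measurable M" "integrable M (\<lambda>x. \<bar>f x\<bar> powr p)" "carleson_seq M F \<alpha> C"
  define R where "R = (p / (p - 1)) powr p * C * (\<integral>x. \<bar>f x\<bar> powr p \<partial>M)"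
  \<comment> \<open>A negative bound would be truncated by \<open>ennreal\<close>; nonnegativity
    lets the estimate pass to \<open>ereal\<close>.\<close>
  have "0 \<le> R"
    using carleson_seqD(1)[OF assms(1) *(3)] by (simp add: R_def)
  then show "enn2ereal (\<integral>\<^sup>+ x. (\<Sum>n. ennreal (\<alpha> n x * \<bar>real_cond_exp M (F n) f x\<bar> powr p)) \<partial>M)
      \<le> ereal ((p / (p - 1)) powr p * C * (\<integral>x. \<bar>f x\<bar> powr p \<partial>M))"
    using carleson_embedding[OF assms *] unfolding R_def[symmetric]
    by (simp add: less_eq_ennreal.rep_eq)
next
  fix K assume "infinitely_refining M F" "K < (p / (p - 1)) powr p"
  then obtain f :: "'a \<Rightarrow> real" and \<alpha> C where
    "f \<in> borel_measurable M" "integrable M (\<lambda>x. \<bar>f x\<bar> powr p)" "carleson_seq M F \<alpha> C"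
    "ereal (K * C * (\<integral>x. \<bar>f x\<bar> powr p \<partial>M))
      < enn2ereal (\<integral>\<^sup>+ x. (\<Sum>n. ennreal (\<alpha> n x * \<bar>real_cond_exp M (F n) f x\<bar> powr p)) \<partial>M)"
    using carleson_embedding_sharp[OF assms] by blast
  then show "\<exists>(f::'a \<Rightarrow> real) \<alpha> C.
      f \<in> borel_measurable M \<and> integrable M (\<lambda>x. \<bar>f x\<bar> powr p) \<and> carleson_seq M F \<alpha> C \<and>
      enn2ereal (\<integral>\<^sup>+ x. (\<Sum>n. ennreal (\<alpha> n x * \<bar>real_cond_exp M (F n) f x\<bar> powr p)) \<partial>M)
        > ereal (K * C * (\<integral>x. \<bar>f x\<bar> powr p \<partial>M))"
    by (intro exI conjI)
qed

end
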